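(* Let $n\geq 4$ be an integer. Let $\hat{\Delta}_{ss}(n)$ be the clique complex of the graph of strongly separated subsets of $[n]=\{1,\dots,n\}$ with all frozen vertices removed, and let $G=\langle \alpha,w_0\rangle\cong \mathbf{Z}/2\mathbf{Z}\times\mathbf{Z}/2\mathbf{Z}$ act on it by the simplicial symmetries induced by set complementation $\alpha$ and by the reversal $w_0$. Then $\hat{\Delta}_{ss}(n)$ is $G$-homotopy equivalent to the $(n-3)$-sphere $S^{n-3}$, where $S^{n-3}$ is the unit sphere in $\mathbf{R}^{n-2}$ with coordinates labelled $x_2,\dots,x_{n-1}$, on which $\alpha$ acts as the antipodal map and $w_0$ acts by permuting the coordinate axes, replacing each $x_k$ with $x_{n+1-k}$.
   Context: Let $[n]=\{1,2,\dots,n\}$. For disjoint $A,B\subset[n]$ write $A\prec B$ if $\max(A)<\min(B)$, i.e. $a<b$ for all $a\in A$, $b\in B$ (this holds vacuously if $A$ or $B$ is empty). Subsets $A,B\subset[n]$ are strongly separated if $A\smallsetminus B\prec B\smallsetminus A$ or $B\smallsetminus A\prec A\smallsetminus B$. Consider the graph whose vertices are the subsets of $[n]$, two distinct subsets being adjacent when they are strongly separated. A vertex is frozen if it is strongly separated from every subset of $[n]$; the frozen vertices are exactly the initial and final segments of $[n]$ (sets of the form $\{1,\dots,k\}$ or $\{k,\dots,n\}$, including $\varnothing$ and $[n]$). $\hat{\Delta}_{ss}(n)$ is the clique complex of the graph obtained by deleting the frozen vertices: its vertices are the non-frozen subsets of $[n]$ and its faces are the sets of pairwise strongly separated non-frozen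 subsets. $\alpha$ sends a subset $A\subset[n]$ to $[n]\smallsetminus A$, and $w_0$ sends $A$ to $\{n+1-k:k\in A\}$. Both preserve strong separation and hence act simplicially on $\hat{\Delta}_{ss}(n)$. For a group $G$ acting on spaces, a $G$-map is a continuous $G$-equivariant map, $G$-homotopies are homotopies through $G$-maps, and two $G$-spaces are $G$-homotopy equivalent if there are $G$-maps between them in both directions whose composites are $G$-homotopic to the identities. For a simplicial complex with simplicial $G$-action this refers to its geometric realization. *)

theory Defs
  imports
    "HOL-Analysis.Analysis"
    "HOL-Algebra.Group_Action"
    "HOL-Algebra.Elementary_Groups"
begin

section \<open>Strong separation\<close>

definition precedes :: "nat set \<Rightarrow> nat set \<Rightarrow> bool" where
  "precedes A B \<longleftrightarrow> (\<forall>a\<in>A. \<forall>b\<in>B. a < b)"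

definition strongly_separated :: "nat set \<Rightarrow> nat set \<Rightarrow> bool" where
  "strongly_separated A B \<longleftrightarrow> precedes (A - B) (B - A) \<or> precedes (B - A) (A - B)"

definition frozen :: "nat \<Rightarrow> nat set \<Rightarrow> bool" where
  "frozen n A \<longleftrightarrow> A \<subseteq> {1..n} \<and> (\<forall>B. B \<subseteq> {1..n} \<longrightarrow> strongly_separated A B)"

section \<open>Clique complexes and their geometric realization\<close>

text \<open>An abstract simplicial complex is the set of its faces; the empty face is included, which
  does not affect the realization.\<close>

definition clique_complex :: "'v set \<Rightarrow> ('v \<Rightarrow> 'v \<Rightarrow> bool) \<Rightarrow> 'v set set" where
  "clique_complex V E = {F. F \<subseteq> V \<and> finite F \<and> (\<forall>x\<in>F. \<forall>y\<in>F. x \<noteq> y \<longrightarrow> E x y)}"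

definition Delta_ss :: "nat \<Rightarrow> nat set set set" where
  "Delta_ss n = clique_complex {A. A \<subseteq> {1..n} \<and> \<not> frozen n A} strongly_separated"

text \<open>A point is a family of barycentric coordinates whose support is a face.  This is meant for
  complexes with finitely many vertices, where the topology inherited from the product of
  copies of the real line is the usual one.\<close>

definition geometric_realization :: "'v set set \<Rightarrow> ('v \<Rightarrow> real) topology" where
  "geometric_realization K =
     subtopology (product_topology (\<lambda>_. euclideanreal) (\<Union>K))
       {t. (\<forall>v\<in>\<Union>K. 0 \<le> t v) \<and> {v \<in> \<Union>K. t v \<noteq> 0} \<in> K \<and> (\<Sum>v\<in>\<Union>K. t v) = 1}"

text \<open>The self-map of the realization induced by a simplicial self-map of \<open>K\<close>: the affine
  extension of the vertex map \<open>g\<close>, i.e. the sum of \<open>t v * g v\<close> over all vertices \<open>v\<close>.\<close>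

definition realization_map :: "'v set set \<Rightarrow> ('v \<Rightarrow> 'v) \<Rightarrow> ('v \<Rightarrow> real) \<Rightarrow> ('v \<Rightarrow> real)" where
  "realization_map K g =
     (\<lambda>t \<in> topspace (geometric_realization K).
        \<lambda>w \<in> \<Union>K. \<Sum>v \<in> {v \<in> \<Union>K. g v = w}. t v)"

section \<open>Equivariant homotopy equivalence\<close>

definition G_space ::
  "('g, 'm) monoid_scheme \<Rightarrow> 'a topology \<Rightarrow> ('g \<Rightarrow> 'a \<Rightarrow> 'a) \<Rightarrow> bool" where
  "G_space G X \<phi> \<longleftrightarrow>
     group_action G (topspace X) \<phi> \<and> (\<forall>g \<in> carrier G. continuous_map X X (\<phi> g))"

definition equivariant ::
  "('g, 'm) monoid_scheme \<Rightarrow> 'a topology \<Rightarrow> ('g \<Rightarrow> 'a \<Rightarrow> 'a) \<Rightarrow> ('g \<Rightarrow> 'b \<Rightarrow> 'b) \<Rightarrow> ('a \<Rightarrow> 'b) \<Rightarrow> bool"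
  where
  "equivariant G X \<phi> \<psi> f \<longleftrightarrow> (\<forall>g \<in> carrier G. \<forall>x \<in> topspace X. f (\<phi> g x) = \<psi> g (f x))"

definition G_map ::
  "('g, 'm) monoid_scheme \<Rightarrow> 'a topology \<Rightarrow> ('g \<Rightarrow> 'a \<Rightarrow> 'a) \<Rightarrow>
   'b topology \<Rightarrow> ('g \<Rightarrow> 'b \<Rightarrow> 'b) \<Rightarrow> ('a \<Rightarrow> 'b) \<Rightarrow> bool" where
  "G_map G X \<phi> Y \<psi> f \<longleftrightarrow> continuous_map X Y f \<and> equivariant G X \<phi> \<psi> f"

definition G_homotopic ::
  "('g, 'm) monoid_scheme \<Rightarrow> 'a topology \<Rightarrow> ('g \<Rightarrow> 'a \<Rightarrow> 'a) \<Rightarrow>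
   'b topology \<Rightarrow> ('g \<Rightarrow> 'b \<Rightarrow> 'b) \<Rightarrow> ('a \<Rightarrow> 'b) \<Rightarrow> ('a \<Rightarrow> 'b) \<Rightarrow> bool" where
  "G_homotopic G X \<phi> Y \<psi> = homotopic_with (equivariant G X \<phi> \<psi>) X Y"

definition G_homotopy_equivalent ::
  "('g, 'm) monoid_scheme \<Rightarrow> 'a topology \<Rightarrow> ('g \<Rightarrow> 'a \<Rightarrow> 'a) \<Rightarrow>
   'b topology \<Rightarrow> ('g \<Rightarrow> 'b \<Rightarrow> 'b) \<Rightarrow> bool" where
  "G_homotopy_equivalent G X \<phi> Y \<psi> \<longleftrightarrow>
     G_space G X \<phi> \<and> G_space G Y \<psi> \<and>
     (\<exists>f h. G_map G X \<phi> Y \<psi> f \<and> G_map G Y \<psi> X \<phi> h \<and>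
        G_homotopic G X \<phi> X \<phi> (h \<circ> f) id \<and>
        G_homotopic G Y \<psi> Y \<psi> (f \<circ> h) id)"

section \<open>The symmetry group\<close>

text \<open>Elements of \<^const>\<open>BijGroup\<close> are extensional functions, hence the restrictions.\<close>

definition complementation :: "nat \<Rightarrow> nat set \<Rightarrow> nat set" where
  "complementation n = (\<lambda>A \<in> Pow {1..n}. {1..n} - A)"

definition reversal :: "nat \<Rightarrow> nat set \<Rightarrow> nat set" where
  "reversal n = (\<lambda>A \<in> Pow {1..n}. (\<lambda>k. n + 1 - k) ` A)"

definition symmetry_group :: "nat \<Rightarrow> (nat set \<Rightarrow> nat set) monoid" where
  "symmetry_group n =
     subgroup_generated (BijGroup (Pow {1..n})) {complementation n, reversal n}"

section \<open>The sphere\<close>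

text \<open>The unit sphere in Euclidean space with coordinates labelled \<open>2, \<dots>, n - 1\<close>.\<close>

definition labelled_sphere :: "nat \<Rightarrow> (nat \<Rightarrow> real) topology" where
  "labelled_sphere n =
     subtopology (product_topology (\<lambda>_. euclideanreal) {2..n - 1})
       {x. (\<Sum>k\<in>{2..n - 1}. (x k)\<^sup>2) = 1}"

definition sphere_antipode :: "nat \<Rightarrow> (nat \<Rightarrow> real) \<Rightarrow> (nat \<Rightarrow> real)" where
  "sphere_antipode n = (\<lambda>x \<in> topspace (labelled_sphere n). \<lambda>k \<in> {2..n - 1}. - x k)"

definition sphere_reversal :: "nat \<Rightarrow> (nat \<Rightarrow> real) \<Rightarrow> (nat \<Rightarrow> real)" where
  "sphere_reversal n = (\<lambda>x \<in> topspace (labelled_sphere n). \<lambda>k \<in> {2..n - 1}. x (n + 1 - k))"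

end

theory Submission
  imports Defs
begin

text \<open>The idea is to find the sphere inside the complex and to retract onto it by explicit formulas that
treat all coordinates and both signs alike, so that equivariance is visible.

For \<open>2 \<le> j \<le> n - 1\<close> the sets \<open>{j}\<close> and \<open>{1..n} - {j}\<close>, called the poles of \<open>j\<close>, are not frozen.  They
are not separated from each other, but any two poles of different indices are.  So the poles span the
boundary of a cross-polytope in the complex.  This is a sphere with coordinates labelled
\<open>2, \<dots>, n - 1\<close>, complementation exchanges the two poles of each index, and reversal permutes the indices.

A set is separated from a pole of \<open>j\<close> unless it alternates, with the opposite sign, on some triple of
indices with middle term \<open>j\<close> (\<open>pole_separated_iff\<close>).  This suggests the map to the sphere: the
coordinate \<open>j\<close> of a point with barycentric coordinates \<open>t\<close> is the maximum of \<open>t A\<close> over the sets \<open>A\<close>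
alternating at \<open>j\<close> positively, minus the maximum over those alternating negatively.  On the cross-polytope
it gives back the coordinates (\<open>to_sphere_from_sphere\<close>).  For the homotopy from the identity to the
composite in the other order, let a threshold \<open>\<tau>\<close> rise from \<open>0\<close> to \<open>1\<close>, keep of each \<open>t A\<close> only the excess
over \<open>\<tau>\<close>, and put the coordinates, computed with all maxima cut off at \<open>\<tau>\<close>, on the poles.  If the
coordinate \<open>j\<close> is then nonzero, the sets that alternate against its sign have already disappeared, so
the support is still a face (\<open>weight_clique\<close>).

It remains to see that the total mass never vanishes, and that the coordinates are not all zero at the
end.  Both follow from a statement about strongly separated families of sets that are not frozen:
there is an index at which some of them alternate and all that do have the same sign
(\<open>definite_coordinate\<close>).  If the family consists of the sets of points above lines, for a planar point
configuration, a suitable vertex of its convex hull does it.  In general such lines do not exist, and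
the lemma is proved by extracting from the family a relation that plays the role of the order of
the points by height; the point is that this relation has no cycles (\<open>forces_has_sink\<close>).\<close>

section \<open>Alternating triples\<close>

text \<open>Strong separation of \<open>A\<close> and \<open>B\<close> means that the difference of their indicator functions changes
sign at most once.  The proof below works with this form: what is excluded are the triples on
which the difference changes sign twice.\<close>

lemma strongly_separated_iff:
  "strongly_separated A B \<longleftrightarrow>
     (\<forall>i j k. i < j \<and> j < k \<longrightarrow>
        \<not> (i \<in> A - B \<and> j \<in> B - A \<and> k \<in> A - B) \<and>
        \<not> (i \<in> B - A \<and> j \<in> A - B \<and> k \<in> B - A))" (is "?L \<longleftrightarrow> ?R")
proof
  assume ?L
  then show ?R
    unfolding strongly_separated_def precedes_def by (meson less_asym)
next
  assume R: ?R
  show ?L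
  proof (rule ccontr)
    assume "\<not> ?L"
    then obtain a b a' b' where ab: "a \<in> A - B" "b \<in> B - A" "\<not> a < b"
      and ab': "a' \<in> A - B" "b' \<in> B - A" "\<not> b' < a'"
      unfolding strongly_separated_def precedes_def by blast
    have "a \<noteq> b" "a' \<noteq> b'" "a' \<noteq> b"
      using ab ab' by auto
    then have "b < a" "a' < b'" "a' < b \<or> b < a'"
      using ab(3) ab'(3) by auto
    then show False
      using R ab ab' by blast
  qed
qed

lemma strongly_separated_commute: "strongly_separated A B \<longleftrightarrow> strongly_separated B A"
  unfolding strongly_separated_def by blast

lemma strongly_separated_refl: "strongly_separated A A"
  unfolding strongly_separated_def precedes_def by blast

text \<open>The index \<open>j\<close> is the middle term of a triple along which membership in \<open>A\<close> alternates; the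
  sign \<open>s\<close> tells whether the middle term is the one that belongs to \<open>A\<close>.  Carrying the sign as a
  boolean lets complementation act by negating it.\<close>

definition middle :: "nat \<Rightarrow> bool \<Rightarrow> nat set \<Rightarrow> nat \<Rightarrow> bool" where
  "middle n s A j \<longleftrightarrow>
     (j \<in> A \<longleftrightarrow> s) \<and> (\<exists>i\<in>{1..<j}. i \<in> A \<longleftrightarrow> \<not> s) \<and> (\<exists>k\<in>{j<..n}. k \<in> A \<longleftrightarrow> \<not> s)"

lemma middle_range: "middle n s A j \<Longrightarrow> j \<in> {2..n - 1}"
  unfolding middle_def by auto

lemma nonfrozen_has_middle:
  assumes "A \<subseteq> {1..n}" "\<not> frozen n A"
  obtains s j where "middle n s A j"
proof -
  obtain B where B: "B \<subseteq> {1..n}" "\<not> strongly_separated A B"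
    using assms unfolding frozen_def by blast
  then obtain i j k where "i < j" "j < k"
    "i \<in> A - B \<and> j \<in> B - A \<and> k \<in> A - B \<or> i \<in> B - A \<and> j \<in> A - B \<and> k \<in> B - A"
    unfolding strongly_separated_iff by blast
  moreover from this have "1 \<le> i" "k \<le> n"
    using assms(1) B(1) by auto
  ultimately have "middle n (j \<in> A) A j"
    unfolding middle_def by fastforce
  then show ?thesis
    using that by blast
qed

text \<open>The two poles of the coordinate \<open>j\<close>: the set \<open>{j}\<close> for the sign \<open>True\<close> and its complement
for \<open>False\<close>.  They are the sets that alternate at \<open>j\<close> and nowhere else.\<close>

definition pole :: "nat \<Rightarrow> bool \<Rightarrow> nat \<Rightarrow> nat set" where
  "pole n s j = (if s then {j} else {1..n} - {j})"

text \<open>The pole alternates on every triple with middle term \<open>j\<close>, always with the same sign, and on no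
other triple.  So the sets that are not separated from it are those that alternate at \<open>j\<close> with
the opposite sign.\<close>

lemma pole_separated_iff:
  assumes "A \<subseteq> {1..n}" "j \<in> {1..n}"
  shows "strongly_separated (pole n s j) A \<longleftrightarrow> \<not> middle n (\<not> s) A j"
proof -
  have 1: "i \<in> {1..n}" if "i \<in> A" for i
    using that assms by blast
  show ?thesis
  proof (cases s)
    case True
    have "middle n False A j \<longleftrightarrow> j \<notin> A \<and> (\<exists>i\<in>A. i < j) \<and> (\<exists>k\<in>A. j < k)"
      unfolding middle_def using 1 by fastforce
    moreover have "strongly_separated {j} A \<longleftrightarrow> \<not> (j \<notin> A \<and> (\<exists>i\<in>A. i < j) \<and> (\<exists>k\<in>A. j < k))"
      unfolding strongly_separated_iff by (auto; blast)
    ultimately show ?thesis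
      using True by (simp add: pole_def)
  next
    case False
    have "middle n True A j \<longleftrightarrow> j \<in> A \<and> (\<exists>i\<in>{1..n} - A. i < j) \<and> (\<exists>k\<in>{1..n} - A. j < k)"
      unfolding middle_def using 1[of j] by fastforce
    moreover have "strongly_separated ({1..n} - {j}) A \<longleftrightarrow>
        \<not> (j \<in> A \<and> (\<exists>i\<in>{1..n} - A. i < j) \<and> (\<exists>k\<in>{1..n} - A. j < k))"
      unfolding strongly_separated_iff using 1 by (auto; blast)
    ultimately show ?thesis
      using False by (simp add: pole_def)
  qed
qed

lemma pole_subset: "j \<in> {1..n} \<Longrightarrow> pole n s j \<subseteq> {1..n}"
  unfolding pole_def by auto

lemma middle_pole:
  assumes "j \<in> {2..n - 1}"
  shows "middle n s (pole n s' j) k \<longleftrightarrow> k = j \<and> s = s'"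
proof (cases "k = j")
  case True
  have "1 \<in> {1..<j}" "n \<in> {j<..n}" "n \<noteq> j"
    using assms by auto
  moreover have "j \<in> {1..n}" "j \<noteq> 1"
    using assms by auto
  ultimately show ?thesis
    using True assms unfolding middle_def pole_def by (cases s; cases s') auto
next
  case False
  then show ?thesis
    using assms unfolding middle_def pole_def by (cases s; cases s') auto
qed

lemma pole_inject:
  assumes "j \<in> {2..n - 1}" "k \<in> {2..n - 1}"
  shows "pole n s j = pole n s' k \<longleftrightarrow> j = k \<and> s = s'"
  using middle_pole[OF assms(1), of s s j] middle_pole[OF assms(2), of s s' j] by auto

lemma not_frozen_if_middle:
  assumes "A \<subseteq> {1..n}" "middle n s A j"
  shows "\<not> frozen n A"
proof -
  have j: "j \<in> {1..n}"
    using middle_range[OF assms(2)] by auto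
  have "\<not> strongly_separated A (pole n (\<not> s) j)"
    using pole_separated_iff[OF assms(1) j, of "\<not> s"] assms(2)
    by (simp add: strongly_separated_commute)
  then show ?thesis
    using pole_subset[OF j] unfolding frozen_def by blast
qed

section \<open>A coordinate on which a separated family has a sign\<close>

text \<open>Read the sets of \<open>F\<close> as the sets of points \<open>1, \<dots>, n\<close> of a planar configuration, with abscissas
\<open>1, \<dots>, n\<close>, that lie above a line; a strongly separated family behaves as if it came from such
lines, although it need not.  Measure heights relative to the segment from point \<open>1\<close> to point \<open>n\<close>.
A line with exactly one of the ends above it that separates \<open>v\<close> from \<open>u\<close> as below can then only
exist if \<open>v\<close> is higher than \<open>u\<close>.  So \<open>forces n F u v\<close> is the part of the order by height that \<open>F\<close>
reveals.  In the same picture, \<open>middle n True X j\<close> says that \<open>j\<close> lies above a chord of the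
configuration and \<open>middle n False X j\<close> that it lies below one, and the aim of this section is a
point that is only seen on one side, like a vertex of the convex hull.\<close>

definition forces :: "nat \<Rightarrow> nat set set \<Rightarrow> nat \<Rightarrow> nat \<Rightarrow> bool" where
  "forces n F u v \<longleftrightarrow>
     (\<exists>X\<in>F. u \<notin> X \<and> v \<in> X \<and>
        (1 \<in> X \<and> n \<notin> X \<and> u < v \<or> 1 \<notin> X \<and> n \<in> X \<and> v < u))"

text \<open>The lexicographic order on subsets, as a number: the smallest element is the most significant
digit.\<close>

definition binary_value :: "nat \<Rightarrow> nat set \<Rightarrow> nat" where
  "binary_value n A = (\<Sum>i\<in>A. 2 ^ (n - i))"

lemma sum_powers_below:
  assumes "B \<subseteq> {u<..n}"
  shows "(\<Sum>i\<in>B. 2 ^ (n - i)) < (2::nat) ^ (n - u)"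
proof -
  have "(\<Sum>i\<in>B. 2 ^ (n - i)) \<le> (\<Sum>i\<in>{u<..n}. (2::nat) ^ (n - i))"
    using assms by (intro sum_mono2) auto
  also have "\<dots> = (\<Sum>k\<in>{..<n - u}. 2 ^ k)"
    by (rule sum.reindex_bij_witness[of _ "\<lambda>k. n - k" "\<lambda>i. n - i"]) auto
  also have "\<dots> < 2 ^ (n - u)"
    using sum_power2[of "n - u"] by (simp add: lessThan_atLeast0)
  finally show ?thesis .
qed

lemma binary_value_less:
  assumes "A \<subseteq> {1..n}" "B \<subseteq> {1..n}" "precedes (A - B) (B - A)" "A - B \<noteq> {}"
  shows "binary_value n B < binary_value n A"
proof -
  have fin: "finite A" "finite B"
    using assms finite_subset by blast+
  obtain u where u: "u \<in> A - B"
    using assms(4) by blast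
  have "B - A \<subseteq> {u<..n}"
    using u assms unfolding precedes_def by auto
  then have "(\<Sum>i\<in>B - A. 2 ^ (n - i)) < (2::nat) ^ (n - u)"
    by (rule sum_powers_below)
  also have "\<dots> \<le> (\<Sum>i\<in>A - B. 2 ^ (n - i))"
    using u fin by (intro member_le_sum) auto
  finally have "(\<Sum>i\<in>B - A. 2 ^ (n - i)) < (\<Sum>i\<in>A - B. (2::nat) ^ (n - i))" .
  moreover have "binary_value n A = (\<Sum>i\<in>A - B. 2 ^ (n - i)) + (\<Sum>i\<in>A \<inter> B. 2 ^ (n - i))"
    unfolding binary_value_def using sum.Int_Diff[OF fin(1), of _ B] by (simp add: add.commute)
  moreover have "binary_value n B = (\<Sum>i\<in>B - A. 2 ^ (n - i)) + (\<Sum>i\<in>A \<inter> B. 2 ^ (n - i))"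
    unfolding binary_value_def using sum.Int_Diff[OF fin(2), of _ A]
    by (simp add: add.commute Int_commute)
  ultimately show ?thesis
    by linarith
qed

definition separated_family :: "nat \<Rightarrow> nat set set \<Rightarrow> bool" where
  "separated_family n F \<longleftrightarrow>
     F \<subseteq> Pow {1..n} \<and> (\<forall>A\<in>F. \<forall>B\<in>F. strongly_separated A B)"

lemma separated_family_finite: "separated_family n F \<Longrightarrow> finite F"
  unfolding separated_family_def by (meson finite_Pow_iff finite_atLeastAtMost finite_subset)

lemma separated_familyD:
  assumes "separated_family n F" "A \<in> F" "B \<in> F" "i < j" "j < k"
  shows "\<not> (i \<in> A \<and> i \<notin> B \<and> j \<in> B \<and> j \<notin> A \<and> k \<in> A \<and> k \<notin> B)"
  using assms unfolding separated_family_def strongly_separated_iff by blast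

text \<open>A single pair on which \<open>A\<close> and \<open>B\<close> differ in opposite ways tells which of the two differences
comes first, because they are strongly separated.\<close>

lemma binary_value_less_if_exchange:
  assumes F: "separated_family n F" "A \<in> F" "B \<in> F" and "u < v" "u \<in> A" "u \<notin> B" "v \<in> B" "v \<notin> A"
  shows "binary_value n B < binary_value n A"
proof (rule binary_value_less)
  show "A \<subseteq> {1..n}" "B \<subseteq> {1..n}"
    using F unfolding separated_family_def by auto
  show "precedes (A - B) (B - A)"
    using assms unfolding separated_family_def strongly_separated_def precedes_def
    by (meson DiffI less_asym)
qed (use assms in auto)

text \<open>Sort the sets that contain exactly one end by the slope of their lines.  The set at one extreme
of this order is closed under \<^const>\<open>forces\<close>: a set \<open>X\<close> containing the same end that forced an
element out of it would differ from it in the direction that puts \<open>X\<close> beyond the extreme, and a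
set containing the other end that did so would not be separated from it.  The slope order is not
transitive on nested sets, so the extreme is taken with respect to the binary value, which refines
it on pairs that are not nested.\<close>

lemma exists_upclosed:
  assumes F: "separated_family n F" and X: "X \<in> F" "(1 \<in> X) \<noteq> (n \<in> X)"
  obtains A where "A \<in> F"
    "\<And>u v. u \<in> A \<Longrightarrow> u \<in> {2..n - 1} \<Longrightarrow> v \<in> {2..n - 1} \<Longrightarrow> forces n F u v \<Longrightarrow> v \<in> A"
proof (cases "\<exists>X\<in>F. 1 \<in> X \<and> n \<notin> X")
  case True
  define P where "P = {X \<in> F. 1 \<in> X \<and> n \<notin> X}"
  have "finite P" "P \<noteq> {}"
    using separated_family_finite[OF F] True unfolding P_def by auto
  then have "Min (binary_value n ` P) \<in> binary_value n ` P"
    by (intro Min_in) auto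
  then obtain A where A: "A \<in> P" and "binary_value n A = Min (binary_value n ` P)"
    by auto
  then have A_le: "binary_value n A \<le> binary_value n X" if "X \<in> P" for X
    using that \<open>finite P\<close> by simp
  show ?thesis
  proof (rule that[of A])
    show "A \<in> F"
      using A unfolding P_def by simp
    fix u v
    assume u: "u \<in> A" and uv: "u \<in> {2..n - 1}" "v \<in> {2..n - 1}" and "forces n F u v"
    then obtain X where X: "X \<in> F" "u \<notin> X" "v \<in> X"
      "1 \<in> X \<and> n \<notin> X \<and> u < v \<or> 1 \<notin> X \<and> n \<in> X \<and> v < u"
      unfolding forces_def by blast
    show "v \<in> A"
    proof (rule ccontr)
      assume v: "v \<notin> A"
      from X(4) show False
      proof
        assume *: "1 \<in> X \<and> n \<notin> X \<and> u < v"
        then have "binary_value n X < binary_value n A"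
          using binary_value_less_if_exchange[OF F \<open>A \<in> F\<close> X(1)] u v X by blast
        then show False
          using A_le[of X] * X(1) unfolding P_def by simp
      next
        assume *: "1 \<notin> X \<and> n \<in> X \<and> v < u"
        then show False
          using separated_familyD[OF F \<open>A \<in> F\<close> X(1), of 1 v u] A u v X uv unfolding P_def by auto
      qed
    qed
  qed
next
  case False
  define P where "P = {X \<in> F. 1 \<notin> X \<and> n \<in> X}"
  have "finite P" "P \<noteq> {}"
    using separated_family_finite[OF F] False X unfolding P_def by auto
  then have "Max (binary_value n ` P) \<in> binary_value n ` P"
    by (intro Max_in) auto
  then obtain A where A: "A \<in> P" and "binary_value n A = Max (binary_value n ` P)"
    by auto
  then have A_le: "binary_value n X \<le> binary_value n A" if "X \<in> P" for X
    using that \<open>finite P\<close> by simp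
  show ?thesis
  proof (rule that[of A])
    show "A \<in> F"
      using A unfolding P_def by simp
    fix u v
    assume u: "u \<in> A" and uv: "u \<in> {2..n - 1}" "v \<in> {2..n - 1}" and "forces n F u v"
    then obtain X where X: "X \<in> P" "u \<notin> X" "v \<in> X" "v < u"
      using False unfolding forces_def P_def by blast
    show "v \<in> A"
    proof (rule ccontr)
      assume "v \<notin> A"
      then have "binary_value n A < binary_value n X"
        using binary_value_less_if_exchange[OF F _ \<open>A \<in> F\<close>, of X v u] u X unfolding P_def by auto
      then show False
        using A_le[OF X(1)] by simp
    qed
  qed
qed

text \<open>The relation \<^const>\<open>forces\<close> is acyclic, stated as the existence of sinks.  The closed set \<open>A\<close> of
the previous lemma cuts the ground set in two, no arrow leads from \<open>A\<close> to its complement, and an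
arrow that is due to \<open>A\<close> itself never stays on one side.  So if \<open>W\<close> meets \<open>A\<close>, a sink of
\<open>W \<inter> A\<close> with respect to the remaining sets is a sink of \<open>W\<close> for all of them, and if not, a sink
of \<open>W\<close> with respect to the remaining sets is.\<close>

lemma forces_has_sink:
  assumes "separated_family n F" "W \<subseteq> {2..n - 1}" "W \<noteq> {}"
  obtains w where "w \<in> W" "\<And>v. v \<in> W \<Longrightarrow> \<not> forces n F w v"
proof -
  have "\<exists>w\<in>W. \<forall>v\<in>W. \<not> forces n F w v"
    using assms
  proof (induction "card F" arbitrary: F W rule: less_induct)
    case less
    show ?case
    proof (cases "\<exists>X\<in>F. (1 \<in> X) \<noteq> (n \<in> X)")
      case False
      then have "\<not> forces n F u v" for u v
        unfolding forces_def by blast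
      then show ?thesis
        using less.prems(3) by blast
    next
      case True
      then obtain A where A: "A \<in> F"
        "\<And>u v. u \<in> A \<Longrightarrow> u \<in> {2..n - 1} \<Longrightarrow> v \<in> {2..n - 1} \<Longrightarrow> forces n F u v \<Longrightarrow> v \<in> A"
        using exists_upclosed[OF less.prems(1)] by blast
      define W' where "W' = (if W \<inter> A = {} then W else W \<inter> A)"
      have "separated_family n (F - {A})"
        using less.prems(1) unfolding separated_family_def by auto
      moreover have "card (F - {A}) < card F"
        using A(1) separated_family_finite[OF less.prems(1)] by (intro psubset_card_mono) auto
      moreover have W': "W' \<subseteq> W" "W' \<noteq> {}"
        using less.prems(3) unfolding W'_def by auto
      moreover have "W' \<subseteq> {2..n - 1}"
        using W'(1) less.prems(2) by blast
      ultimately obtain w where w: "w \<in> W'" "\<And>v. v \<in> W' \<Longrightarrow> \<not> forces n (F - {A}) w v"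
        using less.hyps[of "F - {A}" W'] by blast
      have "\<not> forces n F w v" if v: "v \<in> W" for v
      proof
        assume *: "forces n F w v"
        have "w \<in> {2..n - 1}" "v \<in> {2..n - 1}"
          using w(1) W'(1) v less.prems(2) by auto
        then have "v \<in> A" if "w \<in> A"
          using A(2) that * by blast
        then have "v \<in> W'" "w \<in> A \<or> v \<notin> A"
          using w(1) v unfolding W'_def by (auto split: if_splits)
        moreover have "forces n (F - {A}) w v"
          using * calculation(2) unfolding forces_def by blast
        ultimately show False
          using w(2) by blast
      qed
      then show ?thesis
        using w(1) W'(1) by blast
    qed
  qed
  then show ?thesis
    using that by blast
qed

text \<open>If \<open>X\<close> contains exactly one of the ends and alternates at \<open>j\<close>, then the outer term of the triple on
the side of the end that agrees with \<open>j\<close> is not that end, and it is comparable with \<open>j\<close>.\<close>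

lemma middle_forces:
  assumes X: "X \<in> F" "(1 \<in> X) \<noteq> (n \<in> X)" and mid: "middle n s X j"
  obtains v where "v \<in> {2..n - 1}" "if s then forces n F v j else forces n F j v"
proof -
  have j: "j \<in> X \<longleftrightarrow> s" "j \<in> {2..n - 1}"
    using mid middle_range[OF mid] unfolding middle_def by blast+
  obtain i k where "i \<in> {1..<j}" "k \<in> {j<..n}" and ik: "i \<in> X \<longleftrightarrow> \<not> s" "k \<in> X \<longleftrightarrow> \<not> s"
    using mid unfolding middle_def by blast
  then have le: "1 \<le> i" "i < j" "j < k" "k \<le> n"
    by simp_all
  show ?thesis
  proof (cases "(1 \<in> X) = s")
    case True
    then have "i \<noteq> 1"
      using ik(1) by auto
    then have "i \<in> {2..n - 1}"
      using le by simp
    moreover have "if s then forces n F i j else forces n F j i"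
      using X True ik(1) j(1) le(2) unfolding forces_def by (cases s) auto
    ultimately show ?thesis
      by (rule that)
  next
    case False
    then have "k \<noteq> n"
      using X(2) ik(2) by auto
    then have "k \<in> {2..n - 1}"
      using le by simp
    moreover have "if s then forces n F k j else forces n F j k"
      using X False ik(2) j(1) le(3) unfolding forces_def by (cases s) auto
    ultimately show ?thesis
      by (rule that)
  qed
qed

text \<open>The points of a set that avoids both ends lie above the segment from \<open>1\<close> to \<open>n\<close>.
Let \<open>S\<close> be the union of the sets of this kind.  It is closed under \<^const>\<open>forces\<close>, so it contains points
that force nothing, and the leftmost of these, \<open>j\<close>, is never below a chord.  For a chord given by
a set with one or both ends this is immediate.  A set \<open>X\<close> avoiding both ends that lacked \<open>j\<close> but had
elements on both sides would be closed under \<^const>\<open>forces\<close>; an element of \<open>X\<close> left of \<open>j\<close> that is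
maximal there is not a sink by the choice of \<open>j\<close>, so an arrow jumps over \<open>j\<close> inside \<open>X\<close>, and the
set responsible for it provides an arrow into \<open>j\<close> or out of \<open>j\<close>.\<close>

lemma definite_coordinate_if_below:
  assumes F: "separated_family n F"
    and D: "D \<in> F" "1 \<notin> D" "n \<notin> D" "D \<noteq> {}"
  obtains j A where "A \<in> F" "middle n True A j" "\<And>X. X \<in> F \<Longrightarrow> \<not> middle n False X j"
proof -
  define low where "low = {X \<in> F. 1 \<notin> X \<and> n \<notin> X}"
  have low_J: "X \<subseteq> {2..n - 1}" if "X \<in> low" for X
  proof
    fix i assume i: "i \<in> X"
    have "X \<subseteq> {1..n}" "1 \<notin> X" "n \<notin> X"
      using F that unfolding separated_family_def low_def by auto
    with i have "i \<in> {1..n}" "i \<noteq> 1" "i \<noteq> n"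
      by auto
    then show "i \<in> {2..n - 1}"
      by auto
  qed
  have up: "v \<in> X" if X: "X \<in> low" and u: "u \<in> X" and v: "v \<in> {2..n - 1}" and f: "forces n F u v" for X u v
  proof (rule ccontr)
    assume vX: "v \<notin> X"
    have XF: "X \<in> F" "1 \<notin> X" "n \<notin> X"
      using X unfolding low_def by auto
    have "u \<in> {2..n - 1}"
      using low_J[OF X] u by blast
    then have uJ: "1 < u" "u < n"
      by auto
    obtain Y where Y: "Y \<in> F" "u \<notin> Y" "v \<in> Y"
      "1 \<in> Y \<and> n \<notin> Y \<and> u < v \<or> 1 \<notin> Y \<and> n \<in> Y \<and> v < u"
      using f unfolding forces_def by blast
    from Y(4) show False
    proof
      assume "1 \<in> Y \<and> n \<notin> Y \<and> u < v"
      then show False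
        using separated_familyD[OF F Y(1) XF(1), of 1 u v] uJ u vX XF Y by auto
    next
      assume "1 \<notin> Y \<and> n \<in> Y \<and> v < u"
      then show False
        using separated_familyD[OF F Y(1) XF(1), of v u n] uJ u vX XF Y by auto
    qed
  qed
  define S where "S = \<Union> low"
  have S: "S \<subseteq> {2..n - 1}" "S \<noteq> {}"
    using low_J D unfolding S_def low_def by auto
  have upS: "v \<in> S" if "u \<in> S" "v \<in> {2..n - 1}" "forces n F u v" for u v
    using up that unfolding S_def by blast
  define T where "T = {u \<in> S. \<forall>v\<in>{2..n - 1}. \<not> forces n F u v}"
  obtain w where "w \<in> S" "\<And>v. v \<in> S \<Longrightarrow> \<not> forces n F w v"
    using forces_has_sink[OF F S] by blast
  then have "w \<in> T"
    using upS unfolding T_def by blast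
  moreover have "finite T"
    using S(1) finite_subset unfolding T_def by (metis (no_types, lifting) finite_atLeastAtMost mem_Collect_eq subsetI subset_trans)
  ultimately have jT: "Min T \<in> T" and j_le: "\<And>u. u \<in> T \<Longrightarrow> Min T \<le> u"
    using Min_in by auto
  define j where "j = Min T"
  have j: "j \<in> {2..n - 1}" and sink: "\<And>v. v \<in> {2..n - 1} \<Longrightarrow> \<not> forces n F j v"
    using jT S(1) unfolding T_def j_def by auto
  obtain A where A: "A \<in> low" "j \<in> A"
    using jT unfolding T_def S_def j_def by blast
  have AF: "A \<in> F" "1 \<notin> A" "n \<notin> A"
    using A(1) unfolding low_def by auto
  show ?thesis
  proof (rule that[of A j])
    show "A \<in> F"
      by (rule AF)
    have "1 \<in> {1..<j}" "n \<in> {j<..n}"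
      using j by auto
    then show "middle n True A j"
      unfolding middle_def using A(2) AF by blast
    fix X assume X: "X \<in> F"
    show "\<not> middle n False X j"
    proof
      assume "middle n False X j"
      then obtain i k where jX: "j \<notin> X" and i: "i \<in> X" "1 \<le> i" "i < j" and k: "k \<in> X" "j < k" "k \<le> n"
        unfolding middle_def by auto
      consider "1 \<in> X" "n \<in> X" | "(1 \<in> X) \<noteq> (n \<in> X)" | "1 \<notin> X" "n \<notin> X"
        by blast
      then show False
      proof cases
        case 1
        then show False
          using separated_familyD[OF F X AF(1), of 1 j n] A(2) AF jX i k by auto
      next
        case 2
        obtain v where "v \<in> {2..n - 1}" "forces n F j v"
          using middle_forces[OF X 2 \<open>middle n False X j\<close>] by auto
        then show False
          using sink by blast
      next
        case 3
        then have Xl: "X \<in> low"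
          using X unfolding low_def by blast
        define W where "W = {u \<in> X. u < j}"
        have W: "W \<subseteq> {2..n - 1}" "W \<noteq> {}"
          using low_J[OF Xl] i unfolding W_def by auto
        obtain u where u: "u \<in> W" "\<And>v. v \<in> W \<Longrightarrow> \<not> forces n F u v"
          using forces_has_sink[OF F W] by blast
        have uX: "u \<in> X" "u < j"
          using u(1) unfolding W_def by auto
        have "u \<in> S"
          using Xl uX unfolding S_def by blast
        moreover have "u \<notin> T"
          using j_le[of u] uX(2) unfolding j_def by auto
        ultimately obtain v where v: "v \<in> {2..n - 1}" "forces n F u v"
          unfolding T_def by blast
        have "v \<in> X"
          using up[OF Xl uX(1) v] .
        then have "j < v"
          using u(2)[of v] v(2) jX unfolding W_def by (metis (no_types, lifting) linorder_neqE_nat mem_Collect_eq)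
        then obtain Y where Y: "Y \<in> F" "u \<notin> Y" "v \<in> Y" "1 \<in> Y" "n \<notin> Y"
          using v(2) uX(2) unfolding forces_def by (meson less_asym less_trans)
        \<comment> \<open>the arrow from \<open>u\<close> to \<open>v\<close> jumps over \<open>j\<close>, so \<open>Y\<close> also compares \<open>j\<close> with one of them\<close>
        show False
        proof (cases "j \<in> Y")
          case True
          then have "forces n F u j"
            using Y uX(2) unfolding forces_def by blast
          then show False
            using up[OF Xl uX(1) j] jX by blast
        next
          case False
          then have "forces n F j v"
            using Y \<open>j < v\<close> unfolding forces_def by blast
          then show False
            using sink v(1) by blast
        qed
      qed
    qed
  qed
qed

lemma strongly_separated_complement:
  assumes "A \<subseteq> E" "B \<subseteq> E"
  shows "strongly_separated (E - A) (E - B) \<longleftrightarrow> strongly_separated A B"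
proof -
  have "(E - A) - (E - B) = B - A" "(E - B) - (E - A) = A - B"
    using assms by auto
  then show ?thesis
    unfolding strongly_separated_def by auto
qed

lemma middle_complement: "middle n s ({1..n} - A) j \<longleftrightarrow> middle n (\<not> s) A j" if "A \<subseteq> {1..n}"
proof (cases "j \<in> {2..n - 1}")
  case True
  then have "j \<in> {1..n} - A \<longleftrightarrow> j \<notin> A"
    by auto
  moreover have "(\<exists>i\<in>{1..<j}. i \<in> {1..n} - A \<longleftrightarrow> \<not> s) \<longleftrightarrow> (\<exists>i\<in>{1..<j}. i \<in> A \<longleftrightarrow> s)"
    by (rule bex_cong) (use True in auto)
  moreover have "(\<exists>k\<in>{j<..n}. k \<in> {1..n} - A \<longleftrightarrow> \<not> s) \<longleftrightarrow> (\<exists>k\<in>{j<..n}. k \<in> A \<longleftrightarrow> s)"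
    by (rule bex_cong) (use True in auto)
  ultimately show ?thesis
    unfolding middle_def by (cases s) simp_all
next
  case False
  then show ?thesis
    using middle_range by blast
qed

text \<open>If every set contains exactly one of the ends, every alternation is visible to \<^const>\<open>forces\<close>.
A highest point among those that are forced up by another one is above a chord, because of the
arrow that leads to it, and below none, because no arrow leaves it.\<close>

lemma definite_coordinate_if_mixed:
  assumes F: "separated_family n F"
    and mixed: "\<And>X. X \<in> F \<Longrightarrow> (1 \<in> X) \<noteq> (n \<in> X)"
    and X: "X \<in> F" "middle n s X j"
  obtains k A where "A \<in> F" "middle n True A k" "\<And>X. X \<in> F \<Longrightarrow> \<not> middle n False X k"
proof -
  define W where "W = {v \<in> {2..n - 1}. \<exists>u\<in>{2..n - 1}. forces n F u v}"
  obtain v where "v \<in> {2..n - 1}" "if s then forces n F v j else forces n F j v"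
    using middle_forces[OF X(1) mixed[OF X(1)] X(2)] .
  moreover have "j \<in> {2..n - 1}"
    using middle_range[OF X(2)] .
  ultimately have "\<exists>u\<in>{2..n - 1}. \<exists>v\<in>{2..n - 1}. forces n F u v"
    by (metis (full_types))
  then have "W \<noteq> {}"
    unfolding W_def by blast
  moreover have "W \<subseteq> {2..n - 1}"
    unfolding W_def by blast
  ultimately obtain w where w: "w \<in> W" "\<And>v. v \<in> W \<Longrightarrow> \<not> forces n F w v"
    using forces_has_sink[OF F] by blast
  have wJ: "w \<in> {2..n - 1}"
    using w(1) unfolding W_def by blast
  have sink: "\<not> forces n F w v" if "v \<in> {2..n - 1}" for v
  proof
    assume "forces n F w v"
    then have "v \<in> W"
      using wJ that unfolding W_def by blast
    then show False
      using w(2) \<open>forces n F w v\<close> by blast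
  qed
  obtain u where u: "u \<in> {2..n - 1}" "forces n F u w"
    using w(1) unfolding W_def by blast
  then obtain Y where Y: "Y \<in> F" "u \<notin> Y" "w \<in> Y"
    "1 \<in> Y \<and> n \<notin> Y \<and> u < w \<or> 1 \<notin> Y \<and> n \<in> Y \<and> w < u"
    unfolding forces_def by blast
  show ?thesis
  proof (rule that[OF Y(1)])
    have ends: "1 \<in> {1..<w}" "n \<in> {w<..n}"
      using wJ by auto
    from Y(4) show "middle n True Y w"
    proof
      assume *: "1 \<in> Y \<and> n \<notin> Y \<and> u < w"
      then have "u \<in> {1..<w}"
        using u(1) by auto
      then show ?thesis
        unfolding middle_def using ends(2) Y(2,3) * by blast
    next
      assume *: "1 \<notin> Y \<and> n \<in> Y \<and> w < u"
      then have "u \<in> {w<..n}"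
        using u(1) by auto
      then show ?thesis
        unfolding middle_def using ends(1) Y(2,3) * by blast
    qed
    fix Z assume Z: "Z \<in> F"
    show "\<not> middle n False Z w"
    proof
      assume "middle n False Z w"
      then obtain v where "v \<in> {2..n - 1}" "forces n F w v"
        using middle_forces[OF Z mixed[OF Z] \<open>middle n False Z w\<close>] by auto
      then show False
        using sink by blast
    qed
  qed
qed

text \<open>The combinatorial heart of the proof: the signs with which the sets of a strongly separated family
alternate at a given index may conflict, but not at every index where one of them alternates.
The case of a set containing both ends follows from that of a set avoiding both by complementation.\<close>

lemma definite_coordinate:
  assumes F: "separated_family n F" and nonfrozen: "\<And>X. X \<in> F \<Longrightarrow> \<not> frozen n X" and "F \<noteq> {}"
  obtains s j A where "A \<in> F" "middle n s A j" "\<And>X. X \<in> F \<Longrightarrow> \<not> middle n (\<not> s) X j"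
proof -
  have sub: "X \<subseteq> {1..n}" if "X \<in> F" for X
    using F that unfolding separated_family_def by blast
  have mid: "\<exists>s j. middle n s X j" if "X \<in> F" for X
    using nonfrozen_has_middle[OF sub[OF that] nonfrozen[OF that]] by blast
  consider (below) "\<exists>D\<in>F. 1 \<notin> D \<and> n \<notin> D" | (above) "\<exists>D\<in>F. 1 \<in> D \<and> n \<in> D"
    | (mixed) "\<not> (\<exists>D\<in>F. 1 \<notin> D \<and> n \<notin> D)" "\<not> (\<exists>D\<in>F. 1 \<in> D \<and> n \<in> D)"
    by argo
  then show ?thesis
  proof cases
    case below
    then obtain D where D: "D \<in> F" "1 \<notin> D" "n \<notin> D"
      by blast
    obtain s j where "middle n s D j"
      using mid[OF D(1)] by blast
    then have "D \<noteq> {}"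
      unfolding middle_def by (cases s) auto
    show ?thesis
    proof (rule definite_coordinate_if_below[OF F D \<open>D \<noteq> {}\<close>])
      fix j A
      assume "A \<in> F" "middle n True A j" "\<And>X. X \<in> F \<Longrightarrow> \<not> middle n False X j"
      then show ?thesis
        by (intro that[of A True j]) simp_all
    qed
  next
    case above
    then obtain D where D: "D \<in> F" "1 \<in> D" "n \<in> D"
      by blast
    let ?c = "\<lambda>X. {1..n} - X"
    have "strongly_separated (?c A) (?c B)" if "A \<in> F" "B \<in> F" for A B
      using F that strongly_separated_complement[OF sub[OF that(1)] sub[OF that(2)]]
      unfolding separated_family_def by simp
    then have F': "separated_family n (?c ` F)"
      unfolding separated_family_def by auto
    have "D \<noteq> {1..n}"
    proof
      assume "D = {1..n}"
      moreover obtain s j where "middle n s D j"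
        using mid[OF D(1)] by blast
      ultimately show False
        unfolding middle_def by (cases s) auto
    qed
    then have D': "?c D \<noteq> {}"
      using sub[OF D(1)] by blast
    have D'': "?c D \<in> ?c ` F" "1 \<notin> ?c D" "n \<notin> ?c D"
      using D by auto
    show ?thesis
    proof (rule definite_coordinate_if_below[OF F' D'' D'])
      fix j B
      assume B: "B \<in> ?c ` F" "middle n True B j"
        and none: "\<And>X. X \<in> ?c ` F \<Longrightarrow> \<not> middle n False X j"
      obtain A where A: "A \<in> F" "middle n True (?c A) j"
        using B by auto
      show ?thesis
      proof (rule that[OF A(1)])
        show "middle n False A j"
          using A(2) middle_complement[OF sub[OF A(1)], of True j] by simp
        show "\<not> middle n (\<not> False) X j" if "X \<in> F" for X
          using none[OF imageI[OF that]] middle_complement[OF sub[OF that], of False j] by simp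
      qed
    qed
  next
    case mixed
    obtain X where X: "X \<in> F"
      using \<open>F \<noteq> {}\<close> by blast
    obtain s j where "middle n s X j"
      using mid[OF X] by blast
    show ?thesis
    proof (rule definite_coordinate_if_mixed[OF F _ X \<open>middle n s X j\<close>])
      show "(1 \<in> Y) \<noteq> (n \<in> Y)" if "Y \<in> F" for Y
        using mixed that by (cases "1 \<in> Y") auto
    next
      fix k A
      assume "A \<in> F" "middle n True A k" "\<And>X. X \<in> F \<Longrightarrow> \<not> middle n False X k"
      then show ?thesis
        by (intro that[of A True k]) simp_all
    qed
  qed
qed

section \<open>The symmetry group\<close>

(* keeps the carrier {1..n} in the form in which the rules about it are stated *)
declare One_nat_def [simp del]

definition mirror :: "nat \<Rightarrow> bool \<Rightarrow> nat \<Rightarrow> nat" where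
  "mirror n b i = (if b then n + 1 - i else i)"

lemma mirror_range: "i \<in> {1..n} \<Longrightarrow> mirror n b i \<in> {1..n}"
  unfolding mirror_def by auto

lemma mirror_inner: "j \<in> {2..n - 1} \<Longrightarrow> mirror n b j \<in> {2..n - 1}"
  unfolding mirror_def by auto

lemma mirror_mirror: "i \<in> {1..n} \<Longrightarrow> mirror n b (mirror n c i) = mirror n (b \<noteq> c) i"
  unfolding mirror_def by auto

lemma inner_in_range: "j \<in> {2..n - 1} \<Longrightarrow> j \<in> {1..n}" for n :: nat
  by auto

text \<open>The four symmetries: \<open>a\<close> tells whether to complement, \<open>b\<close> whether to reverse.\<close>

definition symmetry :: "nat \<Rightarrow> bool \<Rightarrow> bool \<Rightarrow> nat set \<Rightarrow> nat set" where
  "symmetry n a b = (\<lambda>A\<in>Pow {1..n}. {i \<in> {1..n}. (mirror n b i \<in> A) \<noteq> a})"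

lemma mem_symmetry:
  "A \<subseteq> {1..n} \<Longrightarrow> i \<in> {1..n} \<Longrightarrow> i \<in> symmetry n a b A \<longleftrightarrow> (mirror n b i \<in> A) \<noteq> a"
  unfolding symmetry_def by simp

lemma symmetry_subset: "A \<subseteq> {1..n} \<Longrightarrow> symmetry n a b A \<subseteq> {1..n}"
  unfolding symmetry_def by auto

lemma symmetry_symmetry:
  assumes "A \<subseteq> {1..n}"
  shows "symmetry n a b (symmetry n c d A) = symmetry n (a \<noteq> c) (b \<noteq> d) A"
proof (rule Set.set_eqI)
  fix i
  show "i \<in> symmetry n a b (symmetry n c d A) \<longleftrightarrow> i \<in> symmetry n (a \<noteq> c) (b \<noteq> d) A"
  proof (cases "i \<in> {1..n}")
    case True
    have "mirror n d (mirror n b i) = mirror n (b \<noteq> d) i"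
      using mirror_mirror[OF True, of d b] by (cases b; cases d) simp_all
    then show ?thesis
      using True mirror_range[OF True, of b] assms by (auto simp: mem_symmetry symmetry_subset)
  next
    case False
    then show ?thesis
      using symmetry_subset[OF symmetry_subset[OF assms]] symmetry_subset[OF assms] by blast
  qed
qed

lemma symmetry_id: "A \<subseteq> {1..n} \<Longrightarrow> symmetry n False False A = A"
  unfolding symmetry_def mirror_def by auto

lemma symmetry_involution: "A \<subseteq> {1..n} \<Longrightarrow> symmetry n a b (symmetry n a b A) = A"
  by (simp add: symmetry_symmetry symmetry_id)

lemma complementation_eq: "complementation n = symmetry n True False"
  unfolding complementation_def symmetry_def mirror_def by (rule ext) auto

lemma reversal_eq: "reversal n = symmetry n False True"
proof
  fix A
  show "reversal n A = symmetry n False True A"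
  proof (cases "A \<in> Pow {1..n}")
    case True
    then have A: "A \<subseteq> {1..n}"
      by simp
    have "(\<lambda>k. n + 1 - k) ` A = {i \<in> {1..n}. n + 1 - i \<in> A}"
    proof (intro Set.set_eqI iffI)
      fix i assume "i \<in> (\<lambda>k. n + 1 - k) ` A"
      then obtain k where k: "k \<in> A" "i = n + 1 - k"
        by blast
      moreover have "1 \<le> k" "k \<le> n"
        using A k(1) by auto
      ultimately show "i \<in> {i \<in> {1..n}. n + 1 - i \<in> A}"
        by auto
    next
      fix i assume "i \<in> {i \<in> {1..n}. n + 1 - i \<in> A}"
      then show "i \<in> (\<lambda>k. n + 1 - k) ` A"
        by (intro image_eqI[of _ _ "n + 1 - i"]) auto
    qed
    then show ?thesis
      using True unfolding reversal_def symmetry_def mirror_def by simp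
  next
    case False
    then show ?thesis
      unfolding reversal_def symmetry_def by auto
  qed
qed

lemma symmetry_Bij: "symmetry n a b \<in> Bij (Pow {1..n})"
proof -
  have "bij_betw (symmetry n a b) (Pow {1..n}) (Pow {1..n})"
  proof (rule bij_betw_byWitness[where f' = "symmetry n a b"])
    show "symmetry n a b ` Pow {1..n} \<subseteq> Pow {1..n}"
      using symmetry_subset by (intro image_subsetI PowI) simp
    then show "symmetry n a b ` Pow {1..n} \<subseteq> Pow {1..n}" .
  qed (simp_all add: symmetry_involution)
  moreover have "symmetry n a b \<in> extensional (Pow {1..n})"
    unfolding symmetry_def by simp
  ultimately show ?thesis
    unfolding Bij_def by simp
qed

lemma BijGroup_mult_symmetry:
  "symmetry n a b \<otimes>\<^bsub>BijGroup (Pow {1..n})\<^esub> symmetry n c d = symmetry n (a \<noteq> c) (b \<noteq> d)"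
proof -
  have "compose (Pow {1..n}) (symmetry n a b) (symmetry n c d) = symmetry n (a \<noteq> c) (b \<noteq> d)"
  proof (rule extensionalityI[of _ "Pow {1..n}"])
    show "compose (Pow {1..n}) (symmetry n a b) (symmetry n c d) A = symmetry n (a \<noteq> c) (b \<noteq> d) A"
      if "A \<in> Pow {1..n}" for A
      using that symmetry_symmetry[of A n a b c d] by (simp add: compose_eq)
  qed (simp_all add: compose_def symmetry_def)
  then show ?thesis
    by (simp add: BijGroup_def symmetry_Bij)
qed

lemma BijGroup_one_symmetry: "\<one>\<^bsub>BijGroup (Pow {1..n})\<^esub> = symmetry n False False"
proof -
  have "(\<lambda>A\<in>Pow {1..n}. A) = symmetry n False False"
    by (rule extensionalityI[of _ "Pow {1..n}"]) (simp_all add: symmetry_id, simp add: symmetry_def)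
  then show ?thesis
    by (simp add: BijGroup_def)
qed

lemma symmetry_group_group: "group (symmetry_group n)"
  unfolding symmetry_group_def by (rule group.group_subgroup_generated[OF group_BijGroup])

lemma symmetry_group_mult: "symmetry n a b \<otimes>\<^bsub>symmetry_group n\<^esub> symmetry n c d = symmetry n (a \<noteq> c) (b \<noteq> d)"
  unfolding symmetry_group_def by (simp add: BijGroup_mult_symmetry)

lemma symmetry_group_one: "\<one>\<^bsub>symmetry_group n\<^esub> = symmetry n False False"
  unfolding symmetry_group_def by (simp add: BijGroup_one_symmetry)

text \<open>The two generators are commuting involutions, so their products exhaust the group.\<close>

lemma symmetry_group_carrier: "carrier (symmetry_group n) = {symmetry n a b |a b. True}"
proof -
  let ?G = "BijGroup (Pow {1..n})"
  let ?S = "{symmetry n True False, symmetry n False True}"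
  interpret group ?G
    by (rule group_BijGroup)
  have S: "?S \<subseteq> carrier ?G"
    using symmetry_Bij by (simp add: BijGroup_def)
  have carrier: "carrier (symmetry_group n) = generate ?G ?S"
    unfolding symmetry_group_def complementation_eq reversal_eq carrier_subgroup_generated
    using S by (simp add: Int_absorb1)
  have "h \<in> {symmetry n a b |a b. True}" if "h \<in> generate ?G ?S" for h
    using that
  proof induction
    case one
    then show ?case
      by (auto simp: BijGroup_one_symmetry)
  next
    case (incl h)
    then show ?case
      by auto
  next
    case (inv h)
    then obtain a b where h: "h = symmetry n a b"
      by auto
    have "h \<otimes>\<^bsub>?G\<^esub> h = \<one>\<^bsub>?G\<^esub>"
      by (simp add: h BijGroup_mult_symmetry BijGroup_one_symmetry)
    moreover have "h \<in> carrier ?G"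
      by (simp add: h BijGroup_def symmetry_Bij)
    ultimately have "inv\<^bsub>?G\<^esub> h = h"
      using inv_equality by blast
    then show ?case
      using h by blast
  next
    case (eng h1 h2)
    then obtain a b c d where "h1 = symmetry n a b" "h2 = symmetry n c d"
      by blast
    then show ?case
      using BijGroup_mult_symmetry by blast
  qed
  moreover have "symmetry n a b \<in> generate ?G ?S" for a b
  proof -
    have 1: "symmetry n True False \<in> generate ?G ?S" "symmetry n False True \<in> generate ?G ?S"
      by (auto intro: generate.incl)
    have "symmetry n True True = symmetry n True False \<otimes>\<^bsub>?G\<^esub> symmetry n False True"
      by (simp add: BijGroup_mult_symmetry)
    then have "symmetry n True True \<in> generate ?G ?S"
      using 1 generate.eng by metis
    moreover have "symmetry n False False \<in> generate ?G ?S"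
      using generate.one[of ?G ?S] by (simp add: BijGroup_one_symmetry)
    ultimately show ?thesis
      using 1 by (cases a; cases b) simp_all
  qed
  ultimately show ?thesis
    unfolding carrier by blast
qed

text \<open>The parameters of a symmetry can be read off from its values at \<open>{}\<close> and \<open>{1}\<close>.\<close>

definition complements :: "(nat set \<Rightarrow> nat set) \<Rightarrow> bool" where
  "complements g \<longleftrightarrow> g {} \<noteq> {}"

definition reverses :: "nat \<Rightarrow> (nat set \<Rightarrow> nat set) \<Rightarrow> bool" where
  "reverses n g \<longleftrightarrow> (n \<in> g {1}) \<noteq> complements g"

lemma complements_symmetry: "n \<ge> 2 \<Longrightarrow> complements (symmetry n a b) \<longleftrightarrow> a"
  unfolding complements_def symmetry_def by auto

lemma reverses_symmetry: "n \<ge> 2 \<Longrightarrow> reverses n (symmetry n a b) \<longleftrightarrow> b"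
  unfolding reverses_def by (auto simp: complements_symmetry mem_symmetry mirror_def)

lemma symmetry_group_iso:
  assumes "n \<ge> 2"
  shows "symmetry_group n \<cong> integer_mod_group 2 \<times>\<times> integer_mod_group 2"
proof -
  let ?Z = "integer_mod_group 2 \<times>\<times> integer_mod_group 2"
  let ?f = "\<lambda>g. (of_bool (complements g) :: int, of_bool (reverses n g) :: int)"
  have f: "?f (symmetry n a b) = (of_bool a, of_bool b)" for a b
    using assms by (simp add: complements_symmetry reverses_symmetry)
  have Z: "carrier ?Z = {0, 1} \<times> {0, 1}"
    by (auto simp: carrier_integer_mod_group)
  have "?f \<in> hom (symmetry_group n) ?Z"
  proof (rule homI)
    show "?f g \<in> carrier ?Z" for g
      unfolding Z by (cases "complements g"; cases "reverses n g") simp_all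
    fix g h assume "g \<in> carrier (symmetry_group n)" "h \<in> carrier (symmetry_group n)"
    then obtain a b c d where "g = symmetry n a b" "h = symmetry n c d"
      unfolding symmetry_group_carrier by blast
    then show "?f (g \<otimes>\<^bsub>symmetry_group n\<^esub> h) = ?f g \<otimes>\<^bsub>?Z\<^esub> ?f h"
      by (simp only: symmetry_group_mult f)
        (cases a; cases b; cases c; cases d; simp add: mult_integer_mod_group)
  qed
  moreover have "bij_betw ?f (carrier (symmetry_group n)) (carrier ?Z)"
  proof (rule bij_betw_byWitness[where f' = "\<lambda>(x, y). symmetry n (x = 1) (y = 1)"])
    show "\<forall>g\<in>carrier (symmetry_group n). (\<lambda>(x, y). symmetry n (x = 1) (y = 1)) (?f g) = g"
      unfolding symmetry_group_carrier
      by (auto simp: complements_symmetry[OF assms] reverses_symmetry[OF assms])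
    show "\<forall>z\<in>carrier ?Z. ?f ((\<lambda>(x, y). symmetry n (x = 1) (y = 1)) z) = z"
      using f unfolding Z by auto
    show "?f ` carrier (symmetry_group n) \<subseteq> carrier ?Z"
      unfolding Z by auto
    show "(\<lambda>(x, y). symmetry n (x = 1) (y = 1)) ` carrier ?Z \<subseteq> carrier (symmetry_group n)"
      unfolding symmetry_group_carrier by auto
  qed
  ultimately show ?thesis
    unfolding is_iso_def iso_def by blast
qed

section \<open>The symmetries act on the vertices\<close>

definition vertices :: "nat \<Rightarrow> nat set set" where
  "vertices n = {A. A \<subseteq> {1..n} \<and> \<not> frozen n A}"

lemma vertices_subset: "A \<in> vertices n \<Longrightarrow> A \<subseteq> {1..n}"
  unfolding vertices_def by simp

lemma finite_vertices: "finite (vertices n)"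
  by (rule finite_subset[of _ "Pow {1..n}"]) (auto simp: vertices_def)

lemma Delta_ss_iff:
  "F \<in> Delta_ss n \<longleftrightarrow> F \<subseteq> vertices n \<and> (\<forall>A\<in>F. \<forall>B\<in>F. strongly_separated A B)"
proof -
  have "finite F" if "F \<subseteq> vertices n"
    using that finite_vertices by (rule finite_subset)
  moreover have "(A \<noteq> B \<longrightarrow> strongly_separated A B) \<longleftrightarrow> strongly_separated A B" for A B
    using strongly_separated_refl[of A] by (cases "A = B") simp_all
  moreover have "Delta_ss n = clique_complex (vertices n) strongly_separated"
    by (simp add: Delta_ss_def vertices_def)
  ultimately show ?thesis
    by (auto simp: clique_complex_def)
qed

lemma Union_Delta_ss: "\<Union> (Delta_ss n) = vertices n"
proof
  show "\<Union> (Delta_ss n) \<subseteq> vertices n"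
    by (auto simp: Delta_ss_iff)
  show "vertices n \<subseteq> \<Union> (Delta_ss n)"
  proof
    fix A assume "A \<in> vertices n"
    then have "{A} \<in> Delta_ss n"
      by (simp add: Delta_ss_iff strongly_separated_refl)
    then show "A \<in> \<Union> (Delta_ss n)"
      by blast
  qed
qed

lemma bex_mirror_below:
  fixes j n :: nat
  assumes "j \<in> {1..n}"
  shows "(\<exists>i\<in>{1..<j}. P (n + 1 - i)) \<longleftrightarrow> (\<exists>k\<in>{n + 1 - j<..n}. P k)"
proof
  assume "\<exists>i\<in>{1..<j}. P (n + 1 - i)"
  then obtain i where "i \<in> {1..<j}" "P (n + 1 - i)"
    by blast
  moreover from this have "n + 1 - i \<in> {n + 1 - j<..n}"
    using assms by auto
  ultimately show "\<exists>k\<in>{n + 1 - j<..n}. P k"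
    by blast
next
  assume "\<exists>k\<in>{n + 1 - j<..n}. P k"
  then obtain k where k: "k \<in> {n + 1 - j<..n}" "P k"
    by blast
  then have "n + 1 - k \<in> {1..<j}" "n + 1 - (n + 1 - k) = k"
    using assms by auto
  then show "\<exists>i\<in>{1..<j}. P (n + 1 - i)"
    using k(2) by metis
qed

lemma bex_mirror_above:
  fixes j n :: nat
  assumes "j \<in> {1..n}"
  shows "(\<exists>k\<in>{j<..n}. P (n + 1 - k)) \<longleftrightarrow> (\<exists>i\<in>{1..<n + 1 - j}. P i)"
proof -
  have "n + 1 - j \<in> {1..n}" "n + 1 - (n + 1 - j) = j"
    using assms by auto
  moreover have "(\<exists>i\<in>{1..<n + 1 - j}. P (n + 1 - (n + 1 - i))) \<longleftrightarrow> (\<exists>i\<in>{1..<n + 1 - j}. P i)"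
    by (rule bex_cong) auto
  ultimately show ?thesis
    using bex_mirror_below[of "n + 1 - j" n "\<lambda>k. P (n + 1 - k)"] by simp
qed

text \<open>Complementation changes the sign of an alternation and reversal moves its middle term, as the
symmetries of the sphere do with signed coordinates.\<close>

lemma middle_symmetry:
  assumes A: "A \<subseteq> {1..n}" and j: "j \<in> {1..n}"
  shows "middle n s (symmetry n a b A) j \<longleftrightarrow> middle n (s \<noteq> a) A (mirror n b j)"
proof -
  have "j \<in> symmetry n a b A \<longleftrightarrow> (mirror n b j \<in> A) \<noteq> a"
    by (rule mem_symmetry[OF A j])
  moreover have "(\<exists>i\<in>{1..<j}. i \<in> symmetry n a b A \<longleftrightarrow> \<not> s) \<longleftrightarrow>
      (\<exists>i\<in>{1..<j}. (mirror n b i \<in> A) \<longleftrightarrow> \<not> (s \<noteq> a))"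
    by (rule bex_cong) (use j in \<open>auto simp: mem_symmetry[OF A]\<close>)
  moreover have "(\<exists>k\<in>{j<..n}. k \<in> symmetry n a b A \<longleftrightarrow> \<not> s) \<longleftrightarrow>
      (\<exists>k\<in>{j<..n}. (mirror n b k \<in> A) \<longleftrightarrow> \<not> (s \<noteq> a))"
    by (rule bex_cong) (use j in \<open>auto simp: mem_symmetry[OF A]\<close>)
  ultimately have 1: "middle n s (symmetry n a b A) j \<longleftrightarrow>
      ((mirror n b j \<in> A) \<longleftrightarrow> (s \<noteq> a)) \<and>
      (\<exists>i\<in>{1..<j}. (mirror n b i \<in> A) \<longleftrightarrow> \<not> (s \<noteq> a)) \<and>
      (\<exists>k\<in>{j<..n}. (mirror n b k \<in> A) \<longleftrightarrow> \<not> (s \<noteq> a))"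
    unfolding middle_def by (cases a; cases s) simp_all
  show ?thesis
  proof (cases b)
    case False
    then show ?thesis
      unfolding 1 by (simp add: middle_def mirror_def)
  next
    case True
    then have m: "mirror n b i = n + 1 - i" for i
      by (simp add: mirror_def)
    have below: "(\<exists>i\<in>{1..<j}. (mirror n b i \<in> A) \<longleftrightarrow> \<not> (s \<noteq> a)) \<longleftrightarrow>
        (\<exists>k\<in>{n + 1 - j<..n}. k \<in> A \<longleftrightarrow> \<not> (s \<noteq> a))"
      unfolding m using j by (intro bex_mirror_below) simp
    have above: "(\<exists>k\<in>{j<..n}. (mirror n b k \<in> A) \<longleftrightarrow> \<not> (s \<noteq> a)) \<longleftrightarrow>
        (\<exists>i\<in>{1..<n + 1 - j}. i \<in> A \<longleftrightarrow> \<not> (s \<noteq> a))"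
      unfolding m using j by (intro bex_mirror_above) simp
    show ?thesis
      unfolding 1 below above unfolding middle_def m
      by (rule arg_cong2[where f = conj, OF refl conj_commute])
  qed
qed

text \<open>A triple that witnesses failure of separation is carried to another one.\<close>

lemma symmetry_strongly_separated:
  assumes A: "A \<subseteq> {1..n}" and B: "B \<subseteq> {1..n}" and "strongly_separated A B"
  shows "strongly_separated (symmetry n a b A) (symmetry n a b B)"
proof (rule ccontr)
  let ?A = "symmetry n a b A" and ?B = "symmetry n a b B"
  assume "\<not> strongly_separated ?A ?B"
  then obtain i j k where ijk: "i < j" "j < k"
    "i \<in> ?A - ?B \<and> j \<in> ?B - ?A \<and> k \<in> ?A - ?B \<or> i \<in> ?B - ?A \<and> j \<in> ?A - ?B \<and> k \<in> ?B - ?A"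
    unfolding strongly_separated_iff by blast
  have "?A \<subseteq> {1..n}" "?B \<subseteq> {1..n}"
    using A B by (simp_all add: symmetry_subset)
  then have r: "i \<in> {1..n}" "j \<in> {1..n}" "k \<in> {1..n}"
    using ijk(3) by blast+
  let ?m = "mirror n b"
  have m: "(?m i \<in> A - B \<and> ?m j \<in> B - A \<and> ?m k \<in> A - B) \<or> (?m i \<in> B - A \<and> ?m j \<in> A - B \<and> ?m k \<in> B - A)"
    using ijk(3) r A B by (cases a) (auto simp: mem_symmetry)
  show False
  proof (cases b)
    case True
    then have "?m k < ?m j" "?m j < ?m i"
      using ijk(1,2) r by (auto simp: mirror_def)
    then show False
      using m assms(3) unfolding strongly_separated_iff by blast
  next
    case False
    then have "?m i < ?m j" "?m j < ?m k"
      using ijk(1,2) by (auto simp: mirror_def)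
    then show False
      using m assms(3) unfolding strongly_separated_iff by blast
  qed
qed

lemma symmetry_vertices:
  assumes "A \<in> vertices n"
  shows "symmetry n a b A \<in> vertices n"
proof -
  have A: "A \<subseteq> {1..n}" "\<not> frozen n A"
    using assms unfolding vertices_def by auto
  obtain s j where sj: "middle n s A j"
    using nonfrozen_has_middle[OF A] by blast
  then have j: "j \<in> {1..n}"
    using middle_range inner_in_range by blast
  have "mirror n b (mirror n b j) = j"
    using mirror_mirror[OF j] by (simp add: mirror_def)
  then have "middle n (s \<noteq> a) (symmetry n a b A) (mirror n b j)"
    using middle_symmetry[OF A(1) mirror_range[OF j], of "s \<noteq> a" a b b] sj by (cases a) simp_all
  then show ?thesis
    using not_frozen_if_middle[OF symmetry_subset[OF A(1)]] symmetry_subset[OF A(1)]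
    unfolding vertices_def by blast
qed

lemma symmetry_pole:
  assumes j: "j \<in> {1..n}"
  shows "symmetry n a b (pole n s j) = pole n (s \<noteq> a) (mirror n b j)"
proof (rule Set.set_eqI)
  fix i
  show "i \<in> symmetry n a b (pole n s j) \<longleftrightarrow> i \<in> pole n (s \<noteq> a) (mirror n b j)"
  proof (cases "i \<in> {1..n}")
    case True
    have "mirror n b i = j \<longleftrightarrow> i = mirror n b j"
      using True j unfolding mirror_def by auto
    moreover have "x \<in> pole n s y \<longleftrightarrow> (x = y) = s" if "x \<in> {1..n}" for x s y
      using that unfolding pole_def by auto
    ultimately show ?thesis
      using True mirror_range[OF True, of b]
      by (simp add: mem_symmetry[OF pole_subset[OF j]]) (cases s; cases a; simp)
  next
    case False
    then show ?thesis
      using pole_subset[OF mirror_range[OF j]] symmetry_subset[OF pole_subset[OF j]] by blast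
  qed
qed

lemma pole_vertices: "j \<in> {2..n - 1} \<Longrightarrow> pole n s j \<in> vertices n"
  using middle_pole[of j n s s j] not_frozen_if_middle[OF pole_subset[OF inner_in_range], of j n s s j]
    pole_subset[OF inner_in_range, of j n s]
  unfolding vertices_def by blast

section \<open>Actions\<close>

text \<open>Bijectivity comes for free from the inverses in the group.\<close>

lemma group_actionI:
  assumes "group G"
    and ext: "\<And>g. g \<in> carrier G \<Longrightarrow> \<phi> g \<in> extensional E"
    and closed: "\<And>g x. g \<in> carrier G \<Longrightarrow> x \<in> E \<Longrightarrow> \<phi> g x \<in> E"
    and one: "\<And>x. x \<in> E \<Longrightarrow> \<phi> \<one>\<^bsub>G\<^esub> x = x"
    and mult: "\<And>g h x. g \<in> carrier G \<Longrightarrow> h \<in> carrier G \<Longrightarrow> x \<in> E \<Longrightarrow> \<phi> (g \<otimes>\<^bsub>G\<^esub> h) x = \<phi> g (\<phi> h x)"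
  shows "group_action G E \<phi>"
proof -
  interpret group G
    by fact
  have inv: "\<phi> (inv\<^bsub>G\<^esub> g) (\<phi> g x) = x" and inv': "\<phi> g (\<phi> (inv\<^bsub>G\<^esub> g) x) = x"
    if g: "g \<in> carrier G" and x: "x \<in> E" for g x
  proof -
    have "\<phi> (inv\<^bsub>G\<^esub> g) (\<phi> g x) = \<phi> (inv\<^bsub>G\<^esub> g \<otimes>\<^bsub>G\<^esub> g) x"
      using mult[OF inv_closed[OF g] g x] by (rule sym)
    then show "\<phi> (inv\<^bsub>G\<^esub> g) (\<phi> g x) = x"
      unfolding l_inv[OF g] one[OF x] .
    have "\<phi> g (\<phi> (inv\<^bsub>G\<^esub> g) x) = \<phi> (g \<otimes>\<^bsub>G\<^esub> inv\<^bsub>G\<^esub> g) x"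
      using mult[OF g inv_closed[OF g] x] by (rule sym)
    then show "\<phi> g (\<phi> (inv\<^bsub>G\<^esub> g) x) = x"
      unfolding r_inv[OF g] one[OF x] .
  qed
  have "bij_betw (\<phi> g) E E" if g: "g \<in> carrier G" for g
  proof (rule bij_betw_byWitness[where f' = "\<phi> (inv\<^bsub>G\<^esub> g)"])
    show "\<forall>x\<in>E. \<phi> (inv\<^bsub>G\<^esub> g) (\<phi> g x) = x" "\<forall>x\<in>E. \<phi> g (\<phi> (inv\<^bsub>G\<^esub> g) x) = x"
      using inv[OF g] inv'[OF g] by blast+
    show "\<phi> g ` E \<subseteq> E" "\<phi> (inv\<^bsub>G\<^esub> g) ` E \<subseteq> E"
      using closed[OF g] closed[OF inv_closed[OF g]] by blast+
  qed
  then have Bij: "\<phi> g \<in> Bij E" if "g \<in> carrier G" for g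
    using that ext unfolding Bij_def by blast
  have "\<phi> \<in> hom G (BijGroup E)"
  proof (rule homI)
    fix g h assume gh: "g \<in> carrier G" "h \<in> carrier G"
    have "\<phi> (g \<otimes>\<^bsub>G\<^esub> h) = compose E (\<phi> g) (\<phi> h)"
    proof (rule extensionalityI)
      show "\<phi> (g \<otimes>\<^bsub>G\<^esub> h) \<in> extensional E"
        using gh by (intro ext m_closed)
      show "\<phi> (g \<otimes>\<^bsub>G\<^esub> h) x = compose E (\<phi> g) (\<phi> h) x" if "x \<in> E" for x
        using that mult[OF gh that] by (simp add: compose_eq)
    qed (simp add: compose_def)
    then show "\<phi> (g \<otimes>\<^bsub>G\<^esub> h) = \<phi> g \<otimes>\<^bsub>BijGroup E\<^esub> \<phi> h"
      using Bij[OF gh(1)] Bij[OF gh(2)] by (simp add: BijGroup_def)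
  next
    show "\<phi> g \<in> carrier (BijGroup E)" if "g \<in> carrier G" for g
      using Bij[OF that] by (simp add: BijGroup_def)
  qed
  then show ?thesis
    unfolding group_action_def group_hom_def group_hom_axioms_def
    using group_BijGroup is_group by blast
qed

lemma topspace_realization:
  "topspace (geometric_realization (Delta_ss n)) =
     {t \<in> extensional (vertices n). (\<forall>A\<in>vertices n. 0 \<le> t A) \<and>
        (\<forall>A\<in>vertices n. \<forall>B\<in>vertices n. t A \<noteq> 0 \<longrightarrow> t B \<noteq> 0 \<longrightarrow> strongly_separated A B) \<and>
        (\<Sum>A\<in>vertices n. t A) = 1}"
proof -
  have "{A \<in> vertices n. t A \<noteq> 0} \<in> Delta_ss n \<longleftrightarrow>
      (\<forall>A\<in>vertices n. \<forall>B\<in>vertices n. t A \<noteq> 0 \<longrightarrow> t B \<noteq> 0 \<longrightarrow> strongly_separated A B)" for t :: "nat set \<Rightarrow> real"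
    unfolding Delta_ss_iff by blast
  moreover have "(\<Pi>\<^sub>E A\<in>vertices n. topspace euclideanreal) = extensional (vertices n)"
    by (simp add: PiE_def)
  ultimately show ?thesis
    unfolding geometric_realization_def Union_Delta_ss topspace_subtopology topspace_product_topology
      Int_def mem_Collect_eq by simp
qed

lemma continuous_map_realization_coordinate:
  "A \<in> vertices n \<Longrightarrow> continuous_map (geometric_realization (Delta_ss n)) euclideanreal (\<lambda>t. t A)"
  unfolding geometric_realization_def Union_Delta_ss
  by (intro continuous_map_from_subtopology continuous_map_product_projection)

lemma continuous_map_into_realization:
  assumes "\<And>A. A \<in> vertices n \<Longrightarrow> continuous_map X euclideanreal (\<lambda>x. f x A)"
    and "\<And>x. x \<in> topspace X \<Longrightarrow> f x \<in> topspace (geometric_realization (Delta_ss n))"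
  shows "continuous_map X (geometric_realization (Delta_ss n)) f"
proof -
  have "f x \<in> topspace (geometric_realization (Delta_ss n)) \<Longrightarrow> f x \<in> extensional (vertices n)" for x
    by (simp add: topspace_realization)
  then show ?thesis
    using assms unfolding geometric_realization_def Union_Delta_ss continuous_map_in_subtopology
    by (auto simp: continuous_map_componentwise)
qed

lemma topspace_sphere:
  "topspace (labelled_sphere n) =
     {x \<in> extensional {2..n - 1}. (\<Sum>k\<in>{2..n - 1}. (x k)\<^sup>2) = 1}"
  unfolding labelled_sphere_def topspace_subtopology topspace_product_topology
  by (auto simp: PiE_def)

lemma continuous_map_sphere_coordinate:
  "j \<in> {2..n - 1} \<Longrightarrow> continuous_map (labelled_sphere n) euclideanreal (\<lambda>x. x j)"
  unfolding labelled_sphere_def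
  by (intro continuous_map_from_subtopology continuous_map_product_projection)

lemma continuous_map_into_sphere:
  assumes "\<And>j. j \<in> {2..n - 1} \<Longrightarrow> continuous_map X euclideanreal (\<lambda>x. f x j)"
    and "\<And>x. x \<in> topspace X \<Longrightarrow> f x \<in> topspace (labelled_sphere n)"
  shows "continuous_map X (labelled_sphere n) f"
proof -
  have "f x \<in> topspace (labelled_sphere n) \<Longrightarrow> f x \<in> extensional {2..n - 1}" for x
    by (simp add: topspace_sphere)
  then show ?thesis
    using assms unfolding labelled_sphere_def continuous_map_in_subtopology
    by (auto simp: continuous_map_componentwise)
qed

lemma sum_symmetry: "(\<Sum>A\<in>vertices n. f (symmetry n a b A)) = (\<Sum>A\<in>vertices n. f A)"
  by (rule sum.reindex_bij_witness[of _ "symmetry n a b" "symmetry n a b"])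
    (auto simp: symmetry_vertices symmetry_involution vertices_subset)

text \<open>A symmetry permutes the vertices and is its own inverse, so the affine extension just permutes the
barycentric coordinates.\<close>

lemma realization_map_symmetry:
  assumes "t \<in> topspace (geometric_realization (Delta_ss n))"
  shows "realization_map (Delta_ss n) (symmetry n a b) t = (\<lambda>A\<in>vertices n. t (symmetry n a b A))"
proof -
  have "(\<Sum>B\<in>{B \<in> vertices n. symmetry n a b B = A}. t B) = t (symmetry n a b A)"
    if A: "A \<in> vertices n" for A
  proof -
    have "{B \<in> vertices n. symmetry n a b B = A} = {symmetry n a b A}"
      using A symmetry_vertices symmetry_involution[OF vertices_subset] by auto
    then show ?thesis
      by simp
  qed
  then show ?thesis
    unfolding realization_map_def Union_Delta_ss using assms by (auto simp: fun_eq_iff)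
qed

lemma realization_map_in_realization:
  assumes t: "t \<in> topspace (geometric_realization (Delta_ss n))"
  shows "realization_map (Delta_ss n) (symmetry n a b) t \<in> topspace (geometric_realization (Delta_ss n))"
proof -
  have "strongly_separated A B"
    if AB: "A \<in> vertices n" "B \<in> vertices n" and "t (symmetry n a b A) \<noteq> 0" "t (symmetry n a b B) \<noteq> 0" for A B
  proof -
    have "strongly_separated (symmetry n a b A) (symmetry n a b B)"
      using that t symmetry_vertices unfolding topspace_realization by blast
    then have "strongly_separated (symmetry n a b (symmetry n a b A)) (symmetry n a b (symmetry n a b B))"
      using AB by (simp add: symmetry_strongly_separated symmetry_subset vertices_subset)
    then show ?thesis
      using AB by (simp add: symmetry_involution vertices_subset)
  qed
  then show ?thesis
    unfolding realization_map_symmetry[OF t] 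
    using t symmetry_vertices by (auto simp: topspace_realization sum_symmetry)
qed

lemma realization_G_space:
  "G_space (symmetry_group n) (geometric_realization (Delta_ss n)) (realization_map (Delta_ss n))"
proof -
  let ?R = "geometric_realization (Delta_ss n)" and ?\<phi> = "realization_map (Delta_ss n)"
  have "group_action (symmetry_group n) (topspace ?R) ?\<phi>"
  proof (rule group_actionI[OF symmetry_group_group])
    show "?\<phi> g \<in> extensional (topspace ?R)" for g
      unfolding realization_map_def by simp
    show "?\<phi> g t \<in> topspace ?R" if "g \<in> carrier (symmetry_group n)" "t \<in> topspace ?R" for g t
      using that realization_map_in_realization unfolding symmetry_group_carrier by blast
    show "?\<phi> \<one>\<^bsub>symmetry_group n\<^esub> t = t" if t: "t \<in> topspace ?R" for t
    proof -
      have "t \<in> extensional (vertices n)"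
        using t by (simp add: topspace_realization)
      then show ?thesis
        using t by (auto simp: symmetry_group_one realization_map_symmetry symmetry_id vertices_subset
            fun_eq_iff extensional_def)
    qed
    show "?\<phi> (g \<otimes>\<^bsub>symmetry_group n\<^esub> h) t = ?\<phi> g (?\<phi> h t)"
      if gh: "g \<in> carrier (symmetry_group n)" "h \<in> carrier (symmetry_group n)" and t: "t \<in> topspace ?R"
      for g h t
    proof -
      obtain a b c d where g: "g = symmetry n a b" and h: "h = symmetry n c d"
        using gh unfolding symmetry_group_carrier by blast
      have "symmetry n (a \<noteq> c) (b \<noteq> d) A = symmetry n c d (symmetry n a b A)" if "A \<in> vertices n" for A
        using symmetry_symmetry[OF vertices_subset[OF that], of c d a b]
        by (cases a; cases b; cases c; cases d) simp_all
      then show ?thesis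
        unfolding g h symmetry_group_mult
          realization_map_symmetry[OF realization_map_in_realization[OF t]]
        unfolding realization_map_symmetry[OF t]
        by (auto simp: fun_eq_iff symmetry_vertices)
    qed
  qed
  moreover have "continuous_map ?R ?R (?\<phi> g)" if carrier: "g \<in> carrier (symmetry_group n)" for g
  proof -
    obtain a b where g: "g = symmetry n a b"
      using carrier unfolding symmetry_group_carrier by blast
    show ?thesis
    proof (rule continuous_map_into_realization)
      show "?\<phi> g t \<in> topspace ?R" if "t \<in> topspace ?R" for t
        using that realization_map_in_realization g by blast
      show "continuous_map ?R euclideanreal (\<lambda>t. ?\<phi> g t A)" if A: "A \<in> vertices n" for A
        by (rule continuous_map_eq[OF continuous_map_realization_coordinate[OF symmetry_vertices[OF A]]])
          (use A in \<open>simp add: g realization_map_symmetry\<close>)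
    qed
  qed
  ultimately show ?thesis
    unfolding G_space_def by blast
qed

definition signed :: "bool \<Rightarrow> real \<Rightarrow> real" where
  "signed s y = (if s then y else - y)"

definition sphere_symmetry :: "nat \<Rightarrow> bool \<Rightarrow> bool \<Rightarrow> (nat \<Rightarrow> real) \<Rightarrow> nat \<Rightarrow> real" where
  "sphere_symmetry n a b =
     (\<lambda>x\<in>topspace (labelled_sphere n). \<lambda>k\<in>{2..n - 1}. signed (\<not> a) (x (mirror n b k)))"

text \<open>The action on the sphere has to be given as a function of the group element itself, not of the
parameters of a symmetry.\<close>

definition sphere_action :: "nat \<Rightarrow> (nat set \<Rightarrow> nat set) \<Rightarrow> (nat \<Rightarrow> real) \<Rightarrow> nat \<Rightarrow> real" where
  "sphere_action n g = sphere_symmetry n (complements g) (reverses n g)"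

lemma sphere_action_symmetry: "n \<ge> 2 \<Longrightarrow> sphere_action n (symmetry n a b) = sphere_symmetry n a b"
  unfolding sphere_action_def by (simp add: complements_symmetry reverses_symmetry)

lemma sphere_antipode_eq: "sphere_antipode n = sphere_symmetry n True False"
  unfolding sphere_antipode_def sphere_symmetry_def signed_def mirror_def by simp

lemma sphere_reversal_eq: "sphere_reversal n = sphere_symmetry n False True"
  unfolding sphere_reversal_def sphere_symmetry_def signed_def mirror_def by simp

lemma sum_mirror: "(\<Sum>j\<in>{2..n - 1}. f (mirror n b j)) = (\<Sum>j\<in>{2..n - 1}. f j)"
  by (rule sum.reindex_bij_witness[of _ "mirror n b" "mirror n b"])
    (auto simp: mirror_def)

lemma sphere_symmetry_in_sphere:
  assumes "x \<in> topspace (labelled_sphere n)"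
  shows "sphere_symmetry n a b x \<in> topspace (labelled_sphere n)"
proof -
  have "(signed (\<not> a) y)\<^sup>2 = y\<^sup>2" for y
    unfolding signed_def by simp
  then show ?thesis
    using assms sum_mirror[where f = "\<lambda>j. (x j)\<^sup>2"] by (simp add: topspace_sphere sphere_symmetry_def)
qed

lemma sphere_G_space:
  assumes "n \<ge> 2"
  shows "G_space (symmetry_group n) (labelled_sphere n) (sphere_action n)"
proof -
  let ?S = "labelled_sphere n"
  have "group_action (symmetry_group n) (topspace ?S) (sphere_action n)"
  proof (rule group_actionI[OF symmetry_group_group])
    show "sphere_action n g \<in> extensional (topspace ?S)" for g
      unfolding sphere_action_def sphere_symmetry_def by simp
    show "sphere_action n g x \<in> topspace ?S" if "g \<in> carrier (symmetry_group n)" "x \<in> topspace ?S" for g x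
      using that sphere_symmetry_in_sphere unfolding sphere_action_def by blast
    show "sphere_action n \<one>\<^bsub>symmetry_group n\<^esub> x = x" if x: "x \<in> topspace ?S" for x
    proof -
      have "x \<in> extensional {2..n - 1}"
        using x by (simp add: topspace_sphere)
      then show ?thesis
        using x by (auto simp: symmetry_group_one sphere_action_symmetry[OF assms] sphere_symmetry_def
            signed_def mirror_def fun_eq_iff extensional_def)
    qed
    show "sphere_action n (g \<otimes>\<^bsub>symmetry_group n\<^esub> h) x = sphere_action n g (sphere_action n h x)"
      if gh: "g \<in> carrier (symmetry_group n)" "h \<in> carrier (symmetry_group n)" and x: "x \<in> topspace ?S"
      for g h x
    proof -
      obtain a b c d where g: "g = symmetry n a b" and h: "h = symmetry n c d"
        using gh unfolding symmetry_group_carrier by blast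
      have "mirror n d (mirror n b j) = mirror n (b \<noteq> d) j" if "j \<in> {2..n - 1}" for j
        using mirror_mirror[OF inner_in_range[OF that], of d b] by (cases b; cases d) simp_all
      moreover have "sphere_symmetry n c d x \<in> topspace ?S"
        using sphere_symmetry_in_sphere[OF x] .
      ultimately show ?thesis
        unfolding g h symmetry_group_mult sphere_action_symmetry[OF assms]
        using x mirror_inner[of _ n b] by (auto simp: sphere_symmetry_def signed_def fun_eq_iff)
    qed
  qed
  moreover have "continuous_map ?S ?S (sphere_action n g)" for g
  proof (rule continuous_map_into_sphere)
    show "sphere_action n g x \<in> topspace ?S" if "x \<in> topspace ?S" for x
      using that sphere_symmetry_in_sphere unfolding sphere_action_def by blast
    show "continuous_map ?S euclideanreal (\<lambda>x. sphere_action n g x j)" if j: "j \<in> {2..n - 1}" for j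
    proof (rule continuous_map_eq)
      show "continuous_map ?S euclideanreal (\<lambda>x. signed (\<not> complements g) (x (mirror n (reverses n g) j)))"
        using continuous_map_sphere_coordinate[OF mirror_inner[OF j]]
        unfolding signed_def by (cases "complements g") (auto intro: continuous_map_minus)
    qed (use j in \<open>simp add: sphere_action_def sphere_symmetry_def\<close>)
  qed
  ultimately show ?thesis
    unfolding G_space_def by blast
qed

section \<open>The two maps and the homotopy\<close>

text \<open>The coordinate \<open>j\<close> of a point of the realization compares the largest weight of a set that
alternates at \<open>j\<close> positively with the largest weight of one that alternates negatively.  These
maxima are taken over nonempty families, as they contain the pole.  Cutting both off at \<open>\<tau>\<close> has the
effect that only sets of weight less than \<open>\<tau>\<close> count against the sign of the coordinate.\<close>

definition height :: "nat \<Rightarrow> bool \<Rightarrow> (nat set \<Rightarrow> real) \<Rightarrow> nat \<Rightarrow> real" where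
  "height n s t j = Max (t ` {A \<in> vertices n. middle n s A j})"

definition coord :: "nat \<Rightarrow> real \<Rightarrow> (nat set \<Rightarrow> real) \<Rightarrow> nat \<Rightarrow> real" where
  "coord n \<tau> t j = min (height n True t j) \<tau> - min (height n False t j) \<tau>"

text \<open>The homeomorphism from the sphere to the boundary of the cross-polytope on the poles, before
normalization: the mass of each coordinate goes to the pole of its sign.\<close>

definition spread :: "nat \<Rightarrow> (nat \<Rightarrow> real) \<Rightarrow> nat set \<Rightarrow> real" where
  "spread n x A = (\<Sum>(s, j)\<in>UNIV \<times> {2..n - 1}. if A = pole n s j then max 0 (signed s (x j)) else 0)"

text \<open>The homotopy at time \<open>\<tau>\<close>, before normalization: of each set only the weight above \<open>\<tau>\<close> is kept, and
the part below \<open>\<tau>\<close> enters through the poles.\<close>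

definition weight :: "nat \<Rightarrow> real \<Rightarrow> (nat set \<Rightarrow> real) \<Rightarrow> nat set \<Rightarrow> real" where
  "weight n \<tau> t A = max 0 (t A - \<tau>) + spread n (coord n \<tau> t) A"

definition barycentric :: "nat \<Rightarrow> (nat set \<Rightarrow> real) \<Rightarrow> nat set \<Rightarrow> real" where
  "barycentric n w = (\<lambda>A\<in>vertices n. w A / (\<Sum>B\<in>vertices n. w B))"

definition from_sphere :: "nat \<Rightarrow> (nat \<Rightarrow> real) \<Rightarrow> nat set \<Rightarrow> real" where
  "from_sphere n x = barycentric n (spread n x)"

definition to_sphere :: "nat \<Rightarrow> (nat set \<Rightarrow> real) \<Rightarrow> nat \<Rightarrow> real" where
  "to_sphere n t = (\<lambda>j\<in>{2..n - 1}. coord n 1 t j / sqrt (\<Sum>k\<in>{2..n - 1}. (coord n 1 t k)\<^sup>2))"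

lemma spread_nonneg: "0 \<le> spread n x A"
  unfolding spread_def by (intro sum_nonneg) auto

lemma spread_pole:
  assumes "j \<in> {2..n - 1}"
  shows "spread n x (pole n s j) = max 0 (signed s (x j))"
proof -
  have "spread n x (pole n s j) =
      (\<Sum>p\<in>UNIV \<times> {2..n - 1}. if p = (s, j) then max 0 (signed s (x j)) else 0)"
    unfolding spread_def
    by (rule sum.cong) (auto simp: pole_inject[OF assms] split: if_splits)
  also have "\<dots> = max 0 (signed s (x j))"
    using assms by (subst sum.delta) auto
  finally show ?thesis .
qed

lemma spread_not_pole: "(\<And>s j. j \<in> {2..n - 1} \<Longrightarrow> A \<noteq> pole n s j) \<Longrightarrow> spread n x A = 0"
  unfolding spread_def by (intro sum.neutral) auto

lemma spread_nonzeroE: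
  assumes "spread n x A \<noteq> 0"
  obtains s j where "j \<in> {2..n - 1}" "A = pole n s j" "signed s (x j) > 0"
proof -
  obtain s j where j: "j \<in> {2..n - 1}" "A = pole n s j"
    using assms spread_not_pole by blast
  have "signed s (x j) > 0"
    using assms unfolding j(2) spread_pole[OF j(1)] by linarith
  then show ?thesis
    using j that by blast
qed

lemma poles_separated:
  assumes j: "j \<in> {2..n - 1}" and k: "k \<in> {2..n - 1}"
    and pos: "signed s (x j) > 0" "signed s' (x k) > 0"
  shows "strongly_separated (pole n s j) (pole n s' k)"
proof -
  have "\<not> (k = j \<and> s = (\<not> s'))"
    using pos unfolding signed_def by (auto split: if_splits)
  then have "\<not> middle n (\<not> s) (pole n s' k) j"
    using middle_pole[OF k, of "\<not> s" s' j] by auto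
  then show ?thesis
    using pole_separated_iff[OF pole_subset[OF inner_in_range[OF k]] inner_in_range[OF j]] by blast
qed

lemma finite_middle: "finite {A \<in> vertices n. middle n s A j}"
  using finite_vertices by simp

lemma pole_in_middle:
  "j \<in> {2..n - 1} \<Longrightarrow> pole n s j \<in> {A \<in> vertices n. middle n s A j}"
  using pole_vertices middle_pole by blast

lemma height_ge: "A \<in> vertices n \<Longrightarrow> middle n s A j \<Longrightarrow> t A \<le> height n s t j"
  unfolding height_def using finite_middle[of n s j] by (intro Max_ge) auto

lemma height_le:
  assumes "j \<in> {2..n - 1}" "\<And>A. A \<in> vertices n \<Longrightarrow> middle n s A j \<Longrightarrow> t A \<le> c"
  shows "height n s t j \<le> c"
  unfolding height_def using pole_in_middle[OF assms(1), of s] finite_middle[of n s j] assms(2)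
  by (subst Max_le_iff) auto

lemma signed_coord:
  "signed s (coord n \<tau> t j) = min (height n s t j) \<tau> - min (height n (\<not> s) t j) \<tau>"
  unfolding signed_def coord_def by (cases s) auto

text \<open>The homotopy does not leave the complex: if the coordinate \<open>j\<close> has sign \<open>s\<close> at time \<open>\<tau>\<close>, then every
set that alternates at \<open>j\<close> with the opposite sign has weight less than \<open>\<tau>\<close> and is already gone,
so the pole of sign \<open>s\<close> is separated from all sets that remain.\<close>

lemma weight_clique:
  assumes t: "t \<in> topspace (geometric_realization (Delta_ss n))" and "0 \<le> \<tau>"
    and A: "A \<in> vertices n" "weight n \<tau> t A \<noteq> 0" and B: "B \<in> vertices n" "weight n \<tau> t B \<noteq> 0"
  shows "strongly_separated A B"
proof -
  have pole_separated: "strongly_separated (pole n s j) C"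
    if j: "j \<in> {2..n - 1}" and pos: "signed s (coord n \<tau> t j) > 0" and C: "C \<in> vertices n" "\<tau> < t C"
    for s j C
  proof -
    have "height n (\<not> s) t j < \<tau>"
      using pos unfolding signed_coord by linarith
    then have "\<not> middle n (\<not> s) C j"
      using height_ge[OF C(1), of "\<not> s" j t] C(2) by auto
    then show ?thesis
      using pole_separated_iff[OF vertices_subset[OF C(1)] inner_in_range[OF j]] by blast
  qed
  have cases: "\<tau> < t C \<or> spread n (coord n \<tau> t) C \<noteq> 0" if "weight n \<tau> t C \<noteq> 0" for C
    using that unfolding weight_def by auto
  show ?thesis
  proof (cases "\<tau> < t A")
    case tA: True
    show ?thesis
    proof (cases "\<tau> < t B")
      case True
      then show ?thesis
        using t A(1) B(1) tA \<open>0 \<le> \<tau>\<close> unfolding topspace_realization by fastforce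
    next
      case False
      then obtain s j where "j \<in> {2..n - 1}" "B = pole n s j" "signed s (coord n \<tau> t j) > 0"
        using cases[OF B(2)] spread_nonzeroE by metis
      then show ?thesis
        using pole_separated A(1) tA strongly_separated_commute by blast
    qed
  next
    case False
    then obtain s j where sj: "j \<in> {2..n - 1}" "A = pole n s j" "signed s (coord n \<tau> t j) > 0"
      using cases[OF A(2)] spread_nonzeroE by metis
    show ?thesis
    proof (cases "\<tau> < t B")
      case True
      then show ?thesis
        using pole_separated sj B(1) by blast
    next
      case False
      then obtain s' k where "k \<in> {2..n - 1}" "B = pole n s' k" "signed s' (coord n \<tau> t k) > 0"
        using cases[OF B(2)] spread_nonzeroE by metis
      then show ?thesis
        using poles_separated[of j n k s "coord n \<tau> t" s'] sj by blast
    qed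
  qed
qed

text \<open>This is where the existence of a definite coordinate enters, applied to the support of \<open>t\<close>: there one
of the two heights is positive and the other one is zero.\<close>

lemma coord_nonzero:
  assumes t: "t \<in> topspace (geometric_realization (Delta_ss n))" and "0 < \<tau>"
  obtains s j where "j \<in> {2..n - 1}" "signed s (coord n \<tau> t j) > 0"
proof -
  define F where "F = {A \<in> vertices n. t A \<noteq> 0}"
  have "separated_family n F"
    using t vertices_subset unfolding separated_family_def topspace_realization F_def by blast
  moreover have "\<not> frozen n A" if "A \<in> F" for A
    using that unfolding F_def vertices_def by simp
  moreover have "F \<noteq> {}"
  proof
    assume "F = {}"
    then have "(\<Sum>A\<in>vertices n. t A) = 0"
      unfolding F_def by (intro sum.neutral) auto
    then show False
      using t by (simp add: topspace_realization)
  qed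
  ultimately obtain s j A where A: "A \<in> F" "middle n s A j"
    and none: "\<And>B. B \<in> F \<Longrightarrow> \<not> middle n (\<not> s) B j"
    by (rule definite_coordinate) blast+
  have j: "j \<in> {2..n - 1}"
    using middle_range[OF A(2)] .
  have "0 < t A"
    using A(1) t unfolding F_def topspace_realization by fastforce
  then have "0 < height n s t j"
    using height_ge[OF _ A(2), of t] A(1) unfolding F_def by auto
  moreover have "height n (\<not> s) t j \<le> 0"
  proof (rule height_le[OF j])
    fix B assume "B \<in> vertices n" "middle n (\<not> s) B j"
    then have "B \<in> vertices n" "B \<notin> F"
      using none by auto
    then show "t B \<le> 0"
      unfolding F_def by simp
  qed
  ultimately have "signed s (coord n \<tau> t j) > 0"
    using \<open>0 < \<tau>\<close> unfolding signed_coord by linarith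
  then show ?thesis
    using that j by blast
qed

lemma weight_nonneg: "0 \<le> weight n \<tau> t A"
  unfolding weight_def using spread_nonneg[of n "coord n \<tau> t" A] by simp

lemma weight_nonzero:
  assumes t: "t \<in> topspace (geometric_realization (Delta_ss n))" and "0 \<le> \<tau>"
  obtains A where "A \<in> vertices n" "0 < weight n \<tau> t A"
proof (cases "\<tau> = 0")
  case True
  have "\<exists>A\<in>vertices n. t A \<noteq> 0"
  proof (rule ccontr)
    assume "\<not> ?thesis"
    then have "(\<Sum>A\<in>vertices n. t A) = 0"
      by (intro sum.neutral) auto
    then show False
      using t by (simp add: topspace_realization)
  qed
  then obtain A where A: "A \<in> vertices n" "t A \<noteq> 0"
    by blast
  then have "0 < t A"
    using t by (auto simp: topspace_realization less_le)
  then show ?thesis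
    using that[OF A(1)] spread_nonneg[of n "coord n \<tau> t" A] True unfolding weight_def by simp
next
  case False
  then have "0 < \<tau>"
    using assms(2) by simp
  then obtain s j where j: "j \<in> {2..n - 1}" "signed s (coord n \<tau> t j) > 0"
    using coord_nonzero[OF t] by metis
  then have "0 < spread n (coord n \<tau> t) (pole n s j)"
    by (simp add: spread_pole)
  then have "0 < weight n \<tau> t (pole n s j)"
    unfolding weight_def by simp
  then show ?thesis
    using that pole_vertices[OF j(1)] by blast
qed

lemma sum_vertices_pos:
  fixes w :: "nat set \<Rightarrow> real"
  assumes "\<And>A. A \<in> vertices n \<Longrightarrow> 0 \<le> w A" "A \<in> vertices n" "0 < w A"
  shows "0 < (\<Sum>B\<in>vertices n. w B)"
  by (rule sum_pos2[where f = w, OF finite_vertices assms(2,3,1)])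

lemma barycentric_in_realization:
  assumes nonneg: "\<And>A. A \<in> vertices n \<Longrightarrow> 0 \<le> w A" and pos: "A \<in> vertices n" "0 < w A"
    and clique: "\<And>A B. A \<in> vertices n \<Longrightarrow> B \<in> vertices n \<Longrightarrow> w A \<noteq> 0 \<Longrightarrow> w B \<noteq> 0 \<Longrightarrow> strongly_separated A B"
  shows "barycentric n w \<in> topspace (geometric_realization (Delta_ss n))"
proof -
  have W: "0 < (\<Sum>B\<in>vertices n. w B)"
    using sum_vertices_pos[of n w A] nonneg pos by blast
  have "(\<Sum>A\<in>vertices n. barycentric n w A) = (\<Sum>A\<in>vertices n. w A) / (\<Sum>B\<in>vertices n. w B)"
    unfolding barycentric_def by (simp flip: sum_divide_distrib)
  then have "(\<Sum>A\<in>vertices n. barycentric n w A) = 1"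
    using W by simp
  moreover have "barycentric n w \<in> extensional (vertices n)"
    unfolding barycentric_def by simp
  moreover have "0 \<le> barycentric n w A" if "A \<in> vertices n" for A
    using that nonneg[OF that] W unfolding barycentric_def by simp
  moreover have "strongly_separated A B"
    if "A \<in> vertices n" "B \<in> vertices n" "barycentric n w A \<noteq> 0" "barycentric n w B \<noteq> 0" for A B
    using that clique[of A B] unfolding barycentric_def by simp
  ultimately show ?thesis
    unfolding topspace_realization by blast
qed

lemma barycentric_weight_in_realization:
  assumes "t \<in> topspace (geometric_realization (Delta_ss n))" "0 \<le> \<tau>"
  shows "barycentric n (weight n \<tau> t) \<in> topspace (geometric_realization (Delta_ss n))"
proof -
  obtain A where "A \<in> vertices n" "0 < weight n \<tau> t A"
    using weight_nonzero[OF assms] .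
  then show ?thesis
    using weight_clique[OF assms] by (intro barycentric_in_realization[of n _ A] weight_nonneg)
qed

lemma sphere_nonzero:
  assumes "x \<in> topspace (labelled_sphere n)"
  obtains s j where "j \<in> {2..n - 1}" "signed s (x j) > 0"
proof -
  have "\<exists>j\<in>{2..n - 1}. x j \<noteq> 0"
  proof (rule ccontr)
    assume "\<not> ?thesis"
    then have "(\<Sum>j\<in>{2..n - 1}. (x j)\<^sup>2) = 0"
      by (intro sum.neutral) auto
    then show False
      using assms by (simp add: topspace_sphere)
  qed
  then obtain j where j: "j \<in> {2..n - 1}" "x j \<noteq> 0"
    by blast
  then have "signed (x j > 0) (x j) > 0"
    unfolding signed_def by auto
  then show ?thesis
    using that j by blast
qed

lemma spread_sum_pos:
  assumes "x \<in> topspace (labelled_sphere n)"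
  shows "0 < (\<Sum>A\<in>vertices n. spread n x A)"
proof -
  obtain s j where j: "j \<in> {2..n - 1}" "signed s (x j) > 0"
    using sphere_nonzero[OF assms] .
  then show ?thesis
    by (intro sum_vertices_pos[OF spread_nonneg pole_vertices[OF j(1), of s]]) (simp add: spread_pole)
qed

lemma from_sphere_in_realization:
  assumes "x \<in> topspace (labelled_sphere n)"
  shows "from_sphere n x \<in> topspace (geometric_realization (Delta_ss n))"
proof -
  obtain s j where j: "j \<in> {2..n - 1}" "signed s (x j) > 0"
    using sphere_nonzero[OF assms] .
  show ?thesis
    unfolding from_sphere_def
  proof (rule barycentric_in_realization)
    show "pole n s j \<in> vertices n" "0 < spread n x (pole n s j)"
      using j by (simp_all add: pole_vertices spread_pole)
    fix A B assume "spread n x A \<noteq> 0" "spread n x B \<noteq> 0"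
    then show "strongly_separated A B"
      using poles_separated by (elim spread_nonzeroE) blast
  qed (rule spread_nonneg)
qed

lemma coord_norm_pos:
  assumes "t \<in> topspace (geometric_realization (Delta_ss n))"
  shows "0 < (\<Sum>k\<in>{2..n - 1}. (coord n 1 t k)\<^sup>2)"
proof -
  obtain s j where j: "j \<in> {2..n - 1}" "signed s (coord n 1 t j) > 0"
    using coord_nonzero[OF assms zero_less_one] by metis
  then have "coord n 1 t j \<noteq> 0"
    unfolding signed_def by (auto split: if_splits)
  then show ?thesis
    using j(1) by (intro sum_pos2[of _ j]) auto
qed

lemma to_sphere_in_sphere:
  assumes "t \<in> topspace (geometric_realization (Delta_ss n))"
  shows "to_sphere n t \<in> topspace (labelled_sphere n)"
  using coord_norm_pos[OF assms]
  by (simp add: topspace_sphere to_sphere_def power_divide flip: sum_divide_distrib)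

lemma realization_le_1:
  assumes "t \<in> topspace (geometric_realization (Delta_ss n))" "A \<in> vertices n"
  shows "t A \<le> 1"
proof -
  have "t A \<le> (\<Sum>A\<in>vertices n. t A)"
    using assms finite_vertices by (intro member_le_sum) (auto simp: topspace_realization)
  then show ?thesis
    using assms by (simp add: topspace_realization)
qed

lemma barycentric_weight_0:
  assumes t: "t \<in> topspace (geometric_realization (Delta_ss n))"
  shows "barycentric n (weight n 0 t) = t"
proof (rule extensionalityI[of _ "vertices n"])
  have "0 \<le> height n s t j" if "j \<in> {2..n - 1}" for s j
    using height_ge[OF pole_vertices[OF that, of s], of s j t] middle_pole[OF that, of s s j]
      pole_vertices[OF that, of s] t unfolding topspace_realization by fastforce
  then have "coord n 0 t j = 0" if "j \<in> {2..n - 1}" for j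
    using that unfolding coord_def by (simp add: min_absorb2)
  then have "spread n (coord n 0 t) A = 0" for A
    unfolding spread_def signed_def by (intro sum.neutral) auto
  then have w: "weight n 0 t A = t A" if "A \<in> vertices n" for A
    using that t unfolding weight_def by (simp add: topspace_realization)
  then have "(\<Sum>A\<in>vertices n. weight n 0 t A) = 1"
    using t by (simp add: topspace_realization)
  then show "barycentric n (weight n 0 t) A = t A" if "A \<in> vertices n" for A
    using that w unfolding barycentric_def by simp
  show "barycentric n (weight n 0 t) \<in> extensional (vertices n)"
    unfolding barycentric_def by simp
  show "t \<in> extensional (vertices n)"
    using t by (simp add: topspace_realization)
qed

text \<open>Positive factors do not matter, because the weights are normalized in the end.\<close>

lemma spread_scale:
  assumes "0 < c" "\<And>j. j \<in> {2..n - 1} \<Longrightarrow> y j = x j / c"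
  shows "spread n y A = spread n x A / c"
proof (cases "\<exists>s j. j \<in> {2..n - 1} \<and> A = pole n s j")
  case True
  then obtain s j where j: "j \<in> {2..n - 1}" "A = pole n s j"
    by blast
  have "max 0 (signed s (x j / c)) = max 0 (signed s (x j)) / c"
    using assms(1) unfolding signed_def by (auto simp: max_def field_simps)
  then show ?thesis
    unfolding j(2) using j(1) assms(2) by (simp add: spread_pole)
next
  case False
  then show ?thesis
    using spread_not_pole[of n A] by simp
qed

lemma barycentric_weight_1:
  assumes t: "t \<in> topspace (geometric_realization (Delta_ss n))"
  shows "barycentric n (weight n 1 t) = from_sphere n (to_sphere n t)"
proof -
  define c where "c = sqrt (\<Sum>k\<in>{2..n - 1}. (coord n 1 t k)\<^sup>2)"
  have c: "0 < c"
    unfolding c_def using coord_norm_pos[OF t] by simp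
  have spread: "spread n (to_sphere n t) A = spread n (coord n 1 t) A / c" for A
    by (rule spread_scale[OF c]) (simp add: to_sphere_def c_def)
  have "weight n 1 t A = c * spread n (to_sphere n t) A" if "A \<in> vertices n" for A
    using realization_le_1[OF t that] c unfolding weight_def spread by simp
  then have "barycentric n (weight n 1 t) = barycentric n (\<lambda>A. c * spread n (to_sphere n t) A)"
    unfolding barycentric_def by (simp cong: restrict_cong)
  also have "\<dots> = barycentric n (spread n (to_sphere n t))"
    unfolding barycentric_def using c by (simp flip: sum_distrib_left)
  finally show ?thesis
    unfolding from_sphere_def .
qed

text \<open>A pole alternates only at its own index and only with its own sign, so the heights of a point of the
cross-polytope are the masses of its poles and the coordinates are recovered exactly.\<close>

lemma to_sphere_from_sphere:
  assumes x: "x \<in> topspace (labelled_sphere n)"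
  shows "to_sphere n (from_sphere n x) = x"
proof -
  define N where "N = (\<Sum>A\<in>vertices n. spread n x A)"
  have N: "0 < N"
    unfolding N_def by (rule spread_sum_pos[OF x])
  let ?t = "from_sphere n x"
  have t: "?t \<in> topspace (geometric_realization (Delta_ss n))"
    by (rule from_sphere_in_realization[OF x])
  have t_eq: "?t A = spread n x A / N" if "A \<in> vertices n" for A
    using that unfolding from_sphere_def barycentric_def N_def by simp
  have height: "height n s ?t j = max 0 (signed s (x j)) / N" if j: "j \<in> {2..n - 1}" for s j
  proof (rule antisym)
    show "height n s ?t j \<le> max 0 (signed s (x j)) / N"
    proof (rule height_le[OF j])
      fix A assume A: "A \<in> vertices n" "middle n s A j"
      have "spread n x A \<le> max 0 (signed s (x j))"
      proof (cases "spread n x A = 0")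
        case False
        then obtain s' k where k: "k \<in> {2..n - 1}" "A = pole n s' k"
          using spread_nonzeroE by metis
        then have "k = j" "s' = s"
          using A(2) middle_pole[OF k(1), of s s' j] by auto
        then show ?thesis
          unfolding k(2) using k(1) by (simp add: spread_pole)
      qed simp
      then show "?t A \<le> max 0 (signed s (x j)) / N"
        using N t_eq[OF A(1)] by (simp add: divide_right_mono)
    qed
    have "?t (pole n s j) = max 0 (signed s (x j)) / N"
      using t_eq[OF pole_vertices[OF j]] spread_pole[OF j] by simp
    then show "max 0 (signed s (x j)) / N \<le> height n s ?t j"
      using height_ge[OF pole_vertices[OF j], of s s j ?t] middle_pole[OF j, of s s j] by simp
  qed
  have coord: "coord n 1 ?t j = x j / N" if j: "j \<in> {2..n - 1}" for j
  proof -
    have le1: "height n s ?t j \<le> 1" for s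
      by (rule height_le[OF j]) (rule realization_le_1[OF t])
    have "coord n 1 ?t j = height n True ?t j - height n False ?t j"
      using le1[of True] le1[of False] unfolding coord_def by simp
    also have "\<dots> = x j / N"
      unfolding height[OF j] signed_def by (auto simp: max_def)
    finally show ?thesis .
  qed
  have "(\<Sum>k\<in>{2..n - 1}. (coord n 1 ?t k)\<^sup>2) = (\<Sum>k\<in>{2..n - 1}. (x k)\<^sup>2 / N\<^sup>2)"
    by (intro sum.cong refl) (simp add: coord power_divide)
  also have "\<dots> = 1 / N\<^sup>2"
    using x by (simp add: topspace_sphere flip: sum_divide_distrib)
  finally have norm: "sqrt (\<Sum>k\<in>{2..n - 1}. (coord n 1 ?t k)\<^sup>2) = 1 / N"
    using N by (simp add: real_sqrt_divide)
  show ?thesis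
  proof (rule extensionalityI[of _ "{2..n - 1}"])
    fix j assume j: "j \<in> {2..n - 1}"
    then have "to_sphere n ?t j = coord n 1 ?t j / (1 / N)"
      unfolding to_sphere_def norm by simp
    then show "to_sphere n ?t j = x j"
      using N coord[OF j] by simp
  next
    show "to_sphere n ?t \<in> extensional {2..n - 1}"
      unfolding to_sphere_def by simp
    show "x \<in> extensional {2..n - 1}"
      using x by (simp add: topspace_sphere)
  qed
qed

section \<open>Continuity\<close>

lemma continuous_map_Max:
  fixes f :: "'a \<Rightarrow> 'b \<Rightarrow> real"
  assumes "finite I" "I \<noteq> {}" "\<And>i. i \<in> I \<Longrightarrow> continuous_map X euclideanreal (f i)"
  shows "continuous_map X euclideanreal (\<lambda>x. Max ((\<lambda>i. f i x) ` I))"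
  using assms
proof (induction rule: finite_ne_induct)
  case (singleton i)
  then show ?case
    by simp
next
  case (insert i I)
  have "(\<lambda>x. Max ((\<lambda>i. f i x) ` insert i I)) = (\<lambda>x. max (f i x) (Max ((\<lambda>i. f i x) ` I)))"
    using insert.hyps by auto
  then show ?case
    using insert by (auto intro: continuous_map_real_max)
qed

lemma continuous_map_coord:
  assumes j: "j \<in> {2..n - 1}"
    and \<tau>: "continuous_map X euclideanreal \<tau>"
    and t: "\<And>A. A \<in> vertices n \<Longrightarrow> continuous_map X euclideanreal (\<lambda>x. t x A)"
  shows "continuous_map X euclideanreal (\<lambda>x. coord n (\<tau> x) (t x) j)"
proof -
  have "continuous_map X euclideanreal (\<lambda>x. height n s (t x) j)" for s
    unfolding height_def
  proof (rule continuous_map_Max)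
    show "{A \<in> vertices n. middle n s A j} \<noteq> {}"
      using pole_in_middle[OF j] by blast
  qed (use finite_middle t in auto)
  then show ?thesis
    unfolding coord_def using \<tau> by (intro continuous_map_diff continuous_map_real_min)
qed

lemma continuous_map_signed:
  "continuous_map X euclideanreal f \<Longrightarrow> continuous_map X euclideanreal (\<lambda>x. signed s (f x))"
  unfolding signed_def by (cases s) (auto intro: continuous_map_minus)

lemma continuous_map_spread:
  assumes "\<And>j. j \<in> {2..n - 1} \<Longrightarrow> continuous_map X euclideanreal (\<lambda>x. y x j)"
  shows "continuous_map X euclideanreal (\<lambda>x. spread n (y x) A)"
proof -
  have "continuous_map X euclideanreal
      (\<lambda>x. case p of (s, j) \<Rightarrow> if A = pole n s j then max 0 (signed s (y x j)) else 0)"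
    if "p \<in> UNIV \<times> {2..n - 1}" for p
  proof (cases p)
    case (Pair s j)
    then have "j \<in> {2..n - 1}"
      using that by simp
    then have "continuous_map X euclideanreal (\<lambda>x. max 0 (signed s (y x j)))"
      using assms by (intro continuous_map_real_max continuous_map_signed) auto
    then show ?thesis
      unfolding Pair by (cases "A = pole n s j") auto
  qed
  then show ?thesis
    unfolding spread_def by (intro continuous_map_sum) auto
qed

lemma continuous_map_barycentric:
  assumes "\<And>A. A \<in> vertices n \<Longrightarrow> continuous_map X euclideanreal (\<lambda>x. w x A)"
    and pos: "\<And>x. x \<in> topspace X \<Longrightarrow> (\<Sum>B\<in>vertices n. w x B) \<noteq> 0"
    and "\<And>x. x \<in> topspace X \<Longrightarrow> barycentric n (w x) \<in> topspace (geometric_realization (Delta_ss n))"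
  shows "continuous_map X (geometric_realization (Delta_ss n)) (\<lambda>x. barycentric n (w x))"
proof (rule continuous_map_into_realization)
  fix A assume A: "A \<in> vertices n"
  have "continuous_map X euclideanreal (\<lambda>x. w x A / (\<Sum>B\<in>vertices n. w x B))"
    using assms(1) A pos finite_vertices
    by (intro continuous_map_real_divide continuous_map_sum) auto
  then show "continuous_map X euclideanreal (\<lambda>x. barycentric n (w x) A)"
    using A unfolding barycentric_def by simp
qed (rule assms(3))

lemma continuous_map_from_sphere:
  "continuous_map (labelled_sphere n) (geometric_realization (Delta_ss n)) (from_sphere n)"
proof -
  have "continuous_map (labelled_sphere n) (geometric_realization (Delta_ss n))
      (\<lambda>x. barycentric n (spread n x))"
  proof (rule continuous_map_barycentric)
    show "continuous_map (labelled_sphere n) euclideanreal (\<lambda>x. spread n x A)" for A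
      by (intro continuous_map_spread continuous_map_sphere_coordinate)
    show "(\<Sum>A\<in>vertices n. spread n x A) \<noteq> 0" if "x \<in> topspace (labelled_sphere n)" for x
      using spread_sum_pos[OF that] by simp
    show "barycentric n (spread n x) \<in> topspace (geometric_realization (Delta_ss n))"
      if "x \<in> topspace (labelled_sphere n)" for x
      using from_sphere_in_realization[OF that] unfolding from_sphere_def .
  qed
  then show ?thesis
    unfolding from_sphere_def .
qed

lemma continuous_map_to_sphere:
  "continuous_map (geometric_realization (Delta_ss n)) (labelled_sphere n) (to_sphere n)"
proof (rule continuous_map_into_sphere)
  let ?R = "geometric_realization (Delta_ss n)"
  fix j assume j: "j \<in> {2..n - 1}"
  have coord: "continuous_map ?R euclideanreal (\<lambda>t. coord n 1 t k)" if "k \<in> {2..n - 1}" for k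
    using continuous_map_coord[OF that, of ?R "\<lambda>_. 1" "\<lambda>t. t"] continuous_map_realization_coordinate
    by simp
  have "continuous_map ?R euclideanreal (\<lambda>t. \<Sum>k\<in>{2..n - 1}. (coord n 1 t k)\<^sup>2)"
    using coord by (intro continuous_map_sum continuous_map_real_pow) auto
  then have "continuous_map ?R euclideanreal (\<lambda>t. sqrt (\<Sum>k\<in>{2..n - 1}. (coord n 1 t k)\<^sup>2))"
    by (rule continuous_map_sqrt)
  then have "continuous_map ?R euclideanreal
      (\<lambda>t. coord n 1 t j / sqrt (\<Sum>k\<in>{2..n - 1}. (coord n 1 t k)\<^sup>2))"
    using coord[OF j] coord_norm_pos[of _ n] by (intro continuous_map_real_divide) fastforce+
  then show "continuous_map ?R euclideanreal (\<lambda>t. to_sphere n t j)"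
    using j unfolding to_sphere_def by simp
qed (rule to_sphere_in_sphere)

lemma continuous_map_homotopy:
  "continuous_map (prod_topology (top_of_set {0..1}) (geometric_realization (Delta_ss n)))
     (geometric_realization (Delta_ss n)) (\<lambda>(\<tau>, t). barycentric n (weight n \<tau> t))"
proof -
  let ?R = "geometric_realization (Delta_ss n)"
  let ?X = "prod_topology (top_of_set {0..1::real}) ?R"
  have \<tau>: "continuous_map ?X euclideanreal fst"
    by (rule continuous_map_into_fulltopology[OF continuous_map_fst])
  have t: "continuous_map ?X euclideanreal (\<lambda>p. snd p A)" if "A \<in> vertices n" for A
    using continuous_map_compose[OF continuous_map_snd continuous_map_realization_coordinate[OF that]]
    by (simp add: o_def)
  have "continuous_map ?X ?R (\<lambda>p. barycentric n (weight n (fst p) (snd p)))"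
  proof (rule continuous_map_barycentric)
    fix A assume "A \<in> vertices n"
    then have "continuous_map ?X euclideanreal (\<lambda>p. max 0 (snd p A - fst p))"
      using t \<tau> by (intro continuous_map_real_max continuous_map_diff) auto
    moreover have "continuous_map ?X euclideanreal (\<lambda>p. spread n (coord n (fst p) (snd p)) A)"
      by (intro continuous_map_spread continuous_map_coord \<tau> t)
    ultimately show "continuous_map ?X euclideanreal (\<lambda>p. weight n (fst p) (snd p) A)"
      unfolding weight_def by (rule continuous_map_add)
  next
    fix p assume "p \<in> topspace ?X"
    then have p: "snd p \<in> topspace ?R" "0 \<le> fst p"
      by auto
    obtain A where "A \<in> vertices n" "0 < weight n (fst p) (snd p) A"
      using weight_nonzero[OF p] .
    then show "(\<Sum>B\<in>vertices n. weight n (fst p) (snd p) B) \<noteq> 0"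
      using sum_vertices_pos[of n "weight n (fst p) (snd p)", OF weight_nonneg] by fastforce
    show "barycentric n (weight n (fst p) (snd p)) \<in> topspace ?R"
      by (rule barycentric_weight_in_realization[OF p])
  qed
  then show ?thesis
    by (simp add: case_prod_beta')
qed

section \<open>Equivariance\<close>

lemma mirror_involution: "j \<in> {2..n - 1} \<Longrightarrow> mirror n b (mirror n b j) = j"
  unfolding mirror_def by auto

lemma height_symmetry:
  assumes j: "j \<in> {2..n - 1}"
    and t': "\<And>A. A \<in> vertices n \<Longrightarrow> t' A = t (symmetry n a b A)"
  shows "height n s t' j = height n (s \<noteq> a) t (mirror n b j)"
proof -
  have mid: "middle n (s \<noteq> a) (symmetry n a b A) (mirror n b j) \<longleftrightarrow> middle n s A j"
    if "A \<in> vertices n" for A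
    using middle_symmetry[OF vertices_subset[OF that] mirror_range[OF inner_in_range[OF j]], of "s \<noteq> a" a b b]
      mirror_involution[OF j] by (cases a) simp_all
  have "symmetry n a b ` {A \<in> vertices n. middle n s A j} =
      {A \<in> vertices n. middle n (s \<noteq> a) A (mirror n b j)}" (is "?L = ?R")
  proof
    show "?L \<subseteq> ?R"
      using mid symmetry_vertices by auto
    show "?R \<subseteq> ?L"
    proof
      fix A assume A: "A \<in> ?R"
      then have "symmetry n a b (symmetry n a b A) = A"
        by (simp add: symmetry_involution vertices_subset)
      then show "A \<in> ?L"
        using A mid[of "symmetry n a b A"] symmetry_vertices[of A n a b]
        by (intro image_eqI[of _ _ "symmetry n a b A"]) auto
    qed
  qed
  then have "t ` {A \<in> vertices n. middle n (s \<noteq> a) A (mirror n b j)} =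
      (\<lambda>A. t (symmetry n a b A)) ` {A \<in> vertices n. middle n s A j}"
    by (metis image_image)
  also have "\<dots> = t' ` {A \<in> vertices n. middle n s A j}"
    by (rule image_cong) (simp_all add: t')
  finally show ?thesis
    unfolding height_def by simp
qed

lemma coord_symmetry:
  assumes j: "j \<in> {2..n - 1}"
    and t': "\<And>A. A \<in> vertices n \<Longrightarrow> t' A = t (symmetry n a b A)"
  shows "coord n \<tau> t' j = signed (\<not> a) (coord n \<tau> t (mirror n b j))"
proof -
  have "height n s t' j = height n (s \<noteq> a) t (mirror n b j)" for s
    by (rule height_symmetry[OF j]) (rule t')
  then show ?thesis
    unfolding coord_def signed_def by simp
qed

lemma spread_symmetry:
  assumes x': "\<And>j. j \<in> {2..n - 1} \<Longrightarrow> x' j = signed (\<not> a) (x (mirror n b j))"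
    and A: "A \<in> vertices n"
  shows "spread n x' A = spread n x (symmetry n a b A)"
proof (cases "\<exists>s j. j \<in> {2..n - 1} \<and> A = pole n s j")
  case True
  then obtain s j where j: "j \<in> {2..n - 1}" and A: "A = pole n s j"
    by blast
  have "signed s (signed (\<not> a) y) = signed (s \<noteq> a) y" for y
    unfolding signed_def by simp
  then show ?thesis
    unfolding A symmetry_pole[OF inner_in_range[OF j]] spread_pole[OF j] spread_pole[OF mirror_inner[OF j]]
    by (simp add: x'[OF j])
next
  case False
  have "symmetry n a b A \<noteq> pole n s j" if "j \<in> {2..n - 1}" for s j
  proof
    assume "symmetry n a b A = pole n s j"
    then have "A = symmetry n a b (pole n s j)"
      using symmetry_involution[OF vertices_subset[OF A], of a b] by simp
    then have "A = pole n (s \<noteq> a) (mirror n b j)"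
      using symmetry_pole[OF inner_in_range[OF that]] by simp
    then show False
      using False mirror_inner[OF that] by blast
  qed
  then show ?thesis
    using False spread_not_pole[of n A] spread_not_pole[of n "symmetry n a b A"] by simp
qed

lemma barycentric_symmetry:
  assumes "\<And>A. A \<in> vertices n \<Longrightarrow> w' A = w (symmetry n a b A)"
  shows "barycentric n w' = (\<lambda>A\<in>vertices n. barycentric n w (symmetry n a b A))"
proof -
  have "(\<Sum>A\<in>vertices n. w' A) = (\<Sum>A\<in>vertices n. w A)"
    using assms sum_symmetry[of w n a b] by simp
  then show ?thesis
    unfolding barycentric_def using assms symmetry_vertices by (auto simp: fun_eq_iff)
qed

lemma equivariantI:
  assumes "\<And>a b x. x \<in> topspace X \<Longrightarrow> f (\<phi> (symmetry n a b) x) = \<psi> (symmetry n a b) (f x)"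
  shows "equivariant (symmetry_group n) X \<phi> \<psi> f"
  using assms unfolding equivariant_def symmetry_group_carrier by blast

lemma homotopy_equivariant:
  assumes "0 \<le> \<tau>"
  shows "equivariant (symmetry_group n) (geometric_realization (Delta_ss n))
    (realization_map (Delta_ss n)) (realization_map (Delta_ss n)) (\<lambda>t. barycentric n (weight n \<tau> t))"
proof (rule equivariantI)
  fix a b t assume t: "t \<in> topspace (geometric_realization (Delta_ss n))"
  let ?t = "\<lambda>A\<in>vertices n. t (symmetry n a b A)"
  have "spread n (coord n \<tau> ?t) A = spread n (coord n \<tau> t) (symmetry n a b A)" if "A \<in> vertices n" for A
    by (rule spread_symmetry[OF _ that]) (simp add: coord_symmetry[where t = t and a = a and b = b])
  then have "weight n \<tau> ?t A = weight n \<tau> t (symmetry n a b A)" if "A \<in> vertices n" for A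
    using that unfolding weight_def by simp
  then show "barycentric n (weight n \<tau> (realization_map (Delta_ss n) (symmetry n a b) t)) =
      realization_map (Delta_ss n) (symmetry n a b) (barycentric n (weight n \<tau> t))"
    unfolding realization_map_symmetry[OF t]
      realization_map_symmetry[OF barycentric_weight_in_realization[OF t assms]]
    by (rule barycentric_symmetry)
qed

lemma from_sphere_equivariant:
  assumes "n \<ge> 2"
  shows "equivariant (symmetry_group n) (labelled_sphere n)
    (sphere_action n) (realization_map (Delta_ss n)) (from_sphere n)"
proof (rule equivariantI)
  fix a b x assume x: "x \<in> topspace (labelled_sphere n)"
  have "spread n (sphere_symmetry n a b x) A = spread n x (symmetry n a b A)" if "A \<in> vertices n" for A
    by (rule spread_symmetry[OF _ that]) (simp add: sphere_symmetry_def x)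
  then show "from_sphere n (sphere_action n (symmetry n a b) x) =
      realization_map (Delta_ss n) (symmetry n a b) (from_sphere n x)"
    unfolding realization_map_symmetry[OF from_sphere_in_realization[OF x]]
      sphere_action_symmetry[OF assms]
    unfolding from_sphere_def
    by (rule barycentric_symmetry)
qed

lemma to_sphere_equivariant:
  assumes "n \<ge> 2"
  shows "equivariant (symmetry_group n) (geometric_realization (Delta_ss n))
    (realization_map (Delta_ss n)) (sphere_action n) (to_sphere n)"
proof (rule equivariantI)
  fix a b t assume t: "t \<in> topspace (geometric_realization (Delta_ss n))"
  let ?t = "\<lambda>A\<in>vertices n. t (symmetry n a b A)"
  have coord: "coord n 1 ?t j = signed (\<not> a) (coord n 1 t (mirror n b j))" if "j \<in> {2..n - 1}" for j
    by (rule coord_symmetry[OF that]) simp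
  have sq: "(signed (\<not> a) y)\<^sup>2 = y\<^sup>2" for y
    unfolding signed_def by simp
  have "(\<Sum>k\<in>{2..n - 1}. (coord n 1 ?t k)\<^sup>2) = (\<Sum>k\<in>{2..n - 1}. (coord n 1 t (mirror n b k))\<^sup>2)"
    by (rule sum.cong) (simp_all add: coord sq)
  also have "\<dots> = (\<Sum>k\<in>{2..n - 1}. (coord n 1 t k)\<^sup>2)"
    by (rule sum_mirror)
  finally have norm: "(\<Sum>k\<in>{2..n - 1}. (coord n 1 ?t k)\<^sup>2) = (\<Sum>k\<in>{2..n - 1}. (coord n 1 t k)\<^sup>2)" .
  have "to_sphere n ?t = sphere_symmetry n a b (to_sphere n t)"
  proof (rule extensionalityI[of _ "{2..n - 1}"])
    fix j assume j: "j \<in> {2..n - 1}"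
    let ?c = "sqrt (\<Sum>k\<in>{2..n - 1}. (coord n 1 t k)\<^sup>2)"
    have "to_sphere n ?t j = coord n 1 ?t j / ?c"
      using j unfolding to_sphere_def norm by simp
    also have "\<dots> = signed (\<not> a) (coord n 1 t (mirror n b j) / ?c)"
      unfolding coord[OF j] signed_def by simp
    also have "\<dots> = signed (\<not> a) (to_sphere n t (mirror n b j))"
      using mirror_inner[OF j, of b] unfolding to_sphere_def by simp
    also have "\<dots> = sphere_symmetry n a b (to_sphere n t) j"
      using j to_sphere_in_sphere[OF t] by (simp add: sphere_symmetry_def)
    finally show "to_sphere n ?t j = sphere_symmetry n a b (to_sphere n t) j" .
  qed (use to_sphere_in_sphere[OF t] in \<open>simp_all add: to_sphere_def sphere_symmetry_def\<close>)
  then show "to_sphere n (realization_map (Delta_ss n) (symmetry n a b) t) =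
      sphere_action n (symmetry n a b) (to_sphere n t)"
    unfolding realization_map_symmetry[OF t] sphere_action_symmetry[OF assms] .
qed

text \<open>Maps matter only on the underlying space, which the group preserves.\<close>

lemma equivariant_cong:
  assumes "G_space G X \<phi>" "\<And>x. x \<in> topspace X \<Longrightarrow> f x = g x"
  shows "equivariant G X \<phi> \<psi> f \<longleftrightarrow> equivariant G X \<phi> \<psi> g"
proof -
  have "\<phi> g x \<in> topspace X" if "g \<in> carrier G" "x \<in> topspace X" for g x
    using assms(1) that unfolding G_space_def continuous_map_def by blast
  then show ?thesis
    using assms(2) unfolding equivariant_def by simp
qed

theorem theorem1p2:
  fixes n :: nat
  assumes "n \<ge> 4"
  shows "symmetry_group n \<cong> integer_mod_group 2 \<times>\<times> integer_mod_group 2 \<and>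
    (\<exists>\<psi>. \<psi> (complementation n) = sphere_antipode n \<and>
         \<psi> (reversal n) = sphere_reversal n \<and>
         G_homotopy_equivalent (symmetry_group n)
           (geometric_realization (Delta_ss n)) (realization_map (Delta_ss n))
           (labelled_sphere n) \<psi>)"
proof -
  have n: "n \<ge> 2"
    using assms by simp
  let ?G = "symmetry_group n" and ?S = "labelled_sphere n" and ?\<psi> = "sphere_action n"
  let ?R = "geometric_realization (Delta_ss n)" and ?\<phi> = "realization_map (Delta_ss n)"
  have R: "G_space ?G ?R ?\<phi>" and S: "G_space ?G ?S ?\<psi>"
    using realization_G_space sphere_G_space[OF n] by blast+
  have f: "G_map ?G ?R ?\<phi> ?S ?\<psi> (to_sphere n)"
    unfolding G_map_def using continuous_map_to_sphere to_sphere_equivariant[OF n] by blast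
  have h: "G_map ?G ?S ?\<psi> ?R ?\<phi> (from_sphere n)"
    unfolding G_map_def using continuous_map_from_sphere from_sphere_equivariant[OF n] by blast
  have "homotopic_with (equivariant ?G ?R ?\<phi> ?\<phi>) ?R ?R id (from_sphere n \<circ> to_sphere n)"
  proof (subst homotopic_with)
    show "equivariant ?G ?R ?\<phi> ?\<phi> f \<longleftrightarrow> equivariant ?G ?R ?\<phi> ?\<phi> g"
      if "\<And>t. t \<in> topspace ?R \<Longrightarrow> f t = g t" for f g
      by (rule equivariant_cong[OF R that])
    let ?H = "\<lambda>(\<tau>, t). barycentric n (weight n \<tau> t)"
    have "continuous_map (prod_topology (top_of_set {0..1}) ?R) ?R ?H"
      "\<forall>t\<in>topspace ?R. ?H (0, t) = id t"
      "\<forall>t\<in>topspace ?R. ?H (1, t) = (from_sphere n \<circ> to_sphere n) t"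
      "\<forall>\<tau>\<in>{0..1}. equivariant ?G ?R ?\<phi> ?\<phi> (\<lambda>t. ?H (\<tau>, t))"
      using continuous_map_homotopy[of n]
      by (simp_all add: barycentric_weight_0 barycentric_weight_1 homotopy_equivariant)
    note H = this
    show "\<exists>H. continuous_map (prod_topology (top_of_set {0..1::real}) ?R) ?R H \<and>
        (\<forall>t\<in>topspace ?R. H (0, t) = id t) \<and>
        (\<forall>t\<in>topspace ?R. H (1, t) = (from_sphere n \<circ> to_sphere n) t) \<and>
        (\<forall>\<tau>\<in>{0..1}. equivariant ?G ?R ?\<phi> ?\<phi> (\<lambda>t. H (\<tau>, t)))"
      by (rule exI[of _ ?H]) (intro conjI H)
  qed
  then have hf: "G_homotopic ?G ?R ?\<phi> ?R ?\<phi> (from_sphere n \<circ> to_sphere n) id"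
    unfolding G_homotopic_def by (rule homotopic_with_symD)
  have id: "equivariant ?G ?S ?\<psi> ?\<psi> id"
    unfolding equivariant_def by simp
  have fh: "G_homotopic ?G ?S ?\<psi> ?S ?\<psi> (to_sphere n \<circ> from_sphere n) id"
    unfolding G_homotopic_def
  proof (rule homotopic_with_equal)
    show "(to_sphere n \<circ> from_sphere n) x = id x" if "x \<in> topspace ?S" for x
      using to_sphere_from_sphere[OF that] by simp
    then show "equivariant ?G ?S ?\<psi> ?\<psi> (to_sphere n \<circ> from_sphere n)"
      using equivariant_cong[OF S, of "to_sphere n \<circ> from_sphere n" id] id by blast
    show "continuous_map ?S ?S (to_sphere n \<circ> from_sphere n)"
      by (rule continuous_map_compose[OF continuous_map_from_sphere continuous_map_to_sphere])
  qed (rule id)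
  have "G_homotopy_equivalent ?G ?R ?\<phi> ?S ?\<psi>"
    unfolding G_homotopy_equivalent_def using R S f h hf fh by blast
  moreover have "?\<psi> (complementation n) = sphere_antipode n" "?\<psi> (reversal n) = sphere_reversal n"
    unfolding complementation_eq reversal_eq sphere_action_symmetry[OF n]
    by (simp_all add: sphere_antipode_eq sphere_reversal_eq)
  ultimately show ?thesis
    using symmetry_group_iso[OF n] by blast
qed

end
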